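(* Let $a,b,s>0$ and let $\beta_{a,b}$ be a Beta random variable with parameters $a,b$. Then the random variable $\beta_{a,b}^{-s}-1$ belongs to $\mathcal{H}$ (that is, it has a hyperbolically completely monotone density on $(0,+\infty)$) if and only if one of the three following conditions is satisfied: (1) $\min(b,s)>1$; (2) $b=1$ or $s=1$; (3) $b<1$, $s\in[1/2,1)$ and $a+b+s\ge 1$.
   Context: For $a,b>0$, $\beta_{a,b}$ denotes a random variable with density $\frac{\Gamma(a+b)}{\Gamma(a)\Gamma(b)}x^{a-1}(1-x)^{b-1}\mathbf{1}_{(0,1)}(x)$. A function $f:(0,+\infty)\to(0,+\infty)$ is hyperbolically completely monotone (HCM) if for every $u>0$ the function $f(uv)f(u/v)$, $v>0$, is completely monotone as a function of the variable $v+1/v$. (A function $h$ is completely monotone on an interval if, on its interior, it is $C^\infty$ with $(-1)^n h^{(n)}\ge 0$ for all integers $n\ge 0$.) $\mathcal{H}$ is the class of positive random variables having an HCM density on $(0,+\infty)$. *)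

theory Defs
  imports "HOL-Probability.Probability"
begin

definition beta_density :: "real \<Rightarrow> real \<Rightarrow> real \<Rightarrow> real" where
  "beta_density a b x =
     Gamma (a + b) / (Gamma a * Gamma b) * x powr (a - 1) * (1 - x) powr (b - 1)
       * indicator {0<..<1} x"

text \<open>
  Being differentiable to every order at each point of the open set \<open>interior I\<close> is the same as
  being smooth there. No condition is imposed at the end points of \<open>I\<close>.
\<close>

definition completely_monotone_on :: "real set \<Rightarrow> (real \<Rightarrow> real) \<Rightarrow> bool" where
  "completely_monotone_on I h \<longleftrightarrow>
     (\<forall>n. \<forall>x \<in> interior I.
        (deriv ^^ n) h differentiable (at x) \<and> (-1) ^ n * (deriv ^^ n) h x \<ge> 0)"

text \<open>
  A function on \<open>(0, \<infinity>)\<close> is represented by a total function whose values on the nonpositive reals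
  are irrelevant. As \<open>v\<close> ranges over \<open>(0, \<infinity>)\<close>, the variable \<open>v + 1 / v\<close> ranges over \<open>[2, \<infinity>)\<close>.
\<close>

definition hyperbolically_completely_monotone :: "(real \<Rightarrow> real) \<Rightarrow> bool" where
  "hyperbolically_completely_monotone f \<longleftrightarrow>
     (\<forall>x>0. f x > 0) \<and>
     (\<forall>u>0. \<exists>h. completely_monotone_on {2..} h \<and>
        (\<forall>v>0. f (u * v) * f (u / v) = h (v + 1 / v)))"

text \<open>
  Positivity of a random variable is meant almost surely. A density is determined only up to null
  sets; some version of it on \<open>(0, \<infinity>)\<close> has to be hyperbolically completely monotone.
\<close>

definition HCM_random_variable :: "'a measure \<Rightarrow> ('a \<Rightarrow> real) \<Rightarrow> bool" where
  "HCM_random_variable M Y \<longleftrightarrow>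
     (AE \<omega> in M. Y \<omega> > 0) \<and>
     (\<exists>f. hyperbolically_completely_monotone f \<and>
        distributed M lborel Y (\<lambda>x. ennreal (f x * indicator {0<..} x)))"

end

theory Submission
  imports Defs "HOL-Complex_Analysis.Complex_Analysis" "HOL-Real_Asymp.Real_Asymp"
begin

text \<open>
  Put \<open>\<alpha> = 1 / s\<close>, \<open>e = b - 1\<close>, \<open>p = 1 + \<alpha> (a + b - 1)\<close>. The variable has a density proportional to
  \<open>g y = (1 + y) powr - p * \<phi> y powr e\<close> with \<open>\<phi> y = (1 + y) powr \<alpha> - 1\<close>.

  Sufficiency. For \<open>0 < \<alpha> < 2\<close> a rectangular contour in the variable \<open>ln (1 + y)\<close> shows that the
  logarithmic derivative of \<open>\<phi> y / y\<close> is the Stieltjes transform of a weight on \<open>{..-1}\<close> whose sign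
  is that of \<open>\<alpha> - 1\<close>. Substituting \<open>y = u v\<close> and \<open>y = u / v\<close> turns it into a Stieltjes transform in
  \<open>w = v + 1 / v\<close>, so the corresponding power of \<open>\<phi> y / y\<close> is hyperbolically completely monotone;
  the remaining factors are powers of \<open>y\<close> and \<open>1 + y\<close>.

  Necessity. The function \<open>g (u v) * g (u / v)\<close> of \<open>w\<close> continues analytically to \<open>w > -2\<close>, and
  complete monotonicity propagates along with it. At \<open>w = 2 cos \<theta>\<close> its value is the square of the
  modulus of \<open>g\<close> at the point of argument \<open>\<theta>\<close> on the circle of radius \<open>u\<close>, so this modulus increases
  with \<open>\<theta>\<close>. This is violated near \<open>-1\<close> if \<open>p < 0\<close>, near the cut if \<open>e * sin (pi * \<alpha>) < 0\<close>, and near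
  the complex zeros of \<open>\<phi>\<close> if \<open>\<alpha> > 2\<close>.
\<close>

section \<open>Completely monotone functions on a half-line\<close>

text \<open>The bound 2 for \<alpha> comes from the poles of the logarithmic derivative: in the
  variable ln (1 + y) those nearest to the real axis, apart from the removable one at 0, must lie
  beyond the lines of imaginary part pi and - pi, onto which the two edges of the cut unfold. At
  \<alpha> = 2 a zero of \<phi> arrives on the cut, at -2, but then \<phi> y / y = 2 + y is
  explicit. For \<alpha> > 2 nonreal zeros appear. Between these values one sign decides everything:
  the power e of \<phi> y / y is admissible when e times the weight is nonpositive. The split-off
  power of y is harmless for every exponent, since its values at u v and u / v multiply to a
  constant; only p must still be nonnegative. For necessity, real w between -2 and 2 belongs to v on
  the unit circle, where u v and u / v are conjugate points; this is why a modulus appears.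
  Monotonicity alone would not survive the continuation to such w, but the sign pattern of all
  derivatives does.\<close>

text \<open>
  The coinductive form makes closure under products and under \<open>B \<mapsto> exp (- B)\<close> follow from the
  first-order product and chain rules, without a Leibniz formula for higher derivatives.
\<close>

coinductive cmono :: "real \<Rightarrow> (real \<Rightarrow> real) \<Rightarrow> bool" for l where
  cmonoI: "(\<And>x. x > l \<Longrightarrow> h x \<ge> 0) \<Longrightarrow>
    (\<And>x. x > l \<Longrightarrow> (h has_real_derivative - k x) (at x)) \<Longrightarrow> cmono l k \<Longrightarrow> cmono l h"

lemma cmonoE:
  assumes "cmono l h"
  obtains k where "\<And>x. x > l \<Longrightarrow> h x \<ge> 0"
    "\<And>x. x > l \<Longrightarrow> (h has_real_derivative - k x) (at x)" "cmono l k"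
  using assms by (cases rule: cmono.cases) auto

lemma cmono_nonneg: "cmono l h \<Longrightarrow> x > l \<Longrightarrow> h x \<ge> 0"
  by (erule cmonoE)

lemma has_real_derivative_cong_Ioi:
  fixes f g :: "real \<Rightarrow> real"
  assumes "\<And>x. x > l \<Longrightarrow> f x = g x" and "x > l"
  shows "(f has_real_derivative D) (at x) \<longleftrightarrow> (g has_real_derivative D) (at x)"
proof (rule DERIV_cong_ev[OF refl _ refl])
  have "\<forall>\<^sub>F y in nhds x. y \<in> {l<..}"
    using assms(2) by (intro eventually_nhds_in_open) auto
  then show "\<forall>\<^sub>F y in nhds x. f y = g y"
    by eventually_elim (use assms(1) in auto)
qed

lemma cmono_cong:
  assumes "cmono l h" "\<And>x. x > l \<Longrightarrow> h x = g x"
  shows "cmono l g"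
proof -
  obtain k where k: "\<And>x. x > l \<Longrightarrow> h x \<ge> 0"
    "\<And>x. x > l \<Longrightarrow> (h has_real_derivative - k x) (at x)" "cmono l k"
    using cmonoE[OF assms(1)] by metis
  show ?thesis
  proof (rule cmonoI)
    show "(g has_real_derivative - k x) (at x)" if "x > l" for x
      using k(2)[OF that] has_real_derivative_cong_Ioi[of l h g x] assms(2) that by blast
  qed (use k assms(2) in fastforce)+
qed

lemma cmono_higher_deriv:
  assumes "cmono l h"
  shows "\<exists>k. cmono l k \<and> (\<forall>x>l. (deriv ^^ n) h x = (-1) ^ n * k x)"
proof (induction n)
  case 0
  then show ?case using assms by auto
next
  case (Suc n)
  then obtain k where k: "cmono l k" "\<And>x. x > l \<Longrightarrow> (deriv ^^ n) h x = (-1) ^ n * k x"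
    by auto
  obtain k' where k': "\<And>x. x > l \<Longrightarrow> (k has_real_derivative - k' x) (at x)" "cmono l k'"
    using cmonoE[OF k(1)] by metis
  have "(deriv ^^ Suc n) h x = (-1) ^ Suc n * k' x" if "x > l" for x
  proof -
    have "((\<lambda>x. (-1) ^ n * k x) has_real_derivative (-1) ^ n * - k' x) (at x)"
      using k'(1)[OF that] by (intro DERIV_cmult)
    then have "((deriv ^^ n) h has_real_derivative (-1) ^ n * - k' x) (at x)"
      using has_real_derivative_cong_Ioi[of l "(deriv ^^ n) h" "\<lambda>x. (-1) ^ n * k x" x] k(2) that
      by simp
    then show ?thesis
      by (simp add: DERIV_imp_deriv)
  qed
  with k'(2) show ?case by blast
qed

lemma cmono_imp_completely_monotone_on:
  assumes "cmono l h"
  shows "completely_monotone_on {l..} h"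
  unfolding completely_monotone_on_def
proof (intro allI ballI conjI)
  fix n x assume "x \<in> interior {l..}"
  then have x: "x > l" by simp
  obtain k where k: "cmono l k" "\<And>x. x > l \<Longrightarrow> (deriv ^^ n) h x = (-1) ^ n * k x"
    using cmono_higher_deriv[OF assms] by blast
  obtain k' where "(k has_real_derivative - k' x) (at x)"
    using cmonoE[OF k(1)] x by metis
  then have "((\<lambda>x. (-1) ^ n * k x) has_real_derivative (-1) ^ n * - k' x) (at x)"
    by (intro DERIV_cmult)
  then have "((deriv ^^ n) h has_real_derivative (-1) ^ n * - k' x) (at x)"
    using has_real_derivative_cong_Ioi[of l "(deriv ^^ n) h" "\<lambda>x. (-1) ^ n * k x" x] k(2) x
    by simp
  then show "(deriv ^^ n) h differentiable at x"
    using real_differentiable_def by blast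
  have "(-1) ^ n * ((-1) ^ n * k x) = k x"
    by (simp flip: mult.assoc power_mult_distrib)
  then show "0 \<le> (-1) ^ n * (deriv ^^ n) h x"
    using k x cmono_nonneg by metis
qed

section \<open>Closure properties of completely monotone functions\<close>

lemma cmono_cmult:
  assumes "cmono l h" "a \<ge> 0"
  shows "cmono l (\<lambda>x. a * h x)"
  using assms(1)
proof (coinduction arbitrary: h)
  case (cmono h)
  obtain k where k: "\<And>x. x > l \<Longrightarrow> h x \<ge> 0"
    "\<And>x. x > l \<Longrightarrow> (h has_real_derivative - k x) (at x)" "cmono l k"
    using cmonoE[OF cmono] by metis
  show ?case
    using k assms(2) by (intro exI[of _ "\<lambda>x. a * h x"] exI[of _ "\<lambda>x. a * k x"])
      (auto intro!: derivative_eq_intros)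
qed

lemma cmono_add:
  assumes "cmono l f" "cmono l g"
  shows "cmono l (\<lambda>x. f x + g x)"
  using assms
proof (coinduction arbitrary: f g)
  case (cmono f g)
  obtain k where k: "\<And>x. x > l \<Longrightarrow> f x \<ge> 0"
    "\<And>x. x > l \<Longrightarrow> (f has_real_derivative - k x) (at x)" "cmono l k"
    using cmonoE[OF cmono(1)] by metis
  obtain k' where k': "\<And>x. x > l \<Longrightarrow> g x \<ge> 0"
    "\<And>x. x > l \<Longrightarrow> (g has_real_derivative - k' x) (at x)" "cmono l k'"
    using cmonoE[OF cmono(2)] by metis
  show ?case
    using k k' by (intro exI[of _ "\<lambda>x. f x + g x"] exI[of _ "\<lambda>x. k x + k' x"])
      (auto intro!: derivative_eq_intros)
qed

lemma cmono_const: "a \<ge> 0 \<Longrightarrow> cmono l (\<lambda>x. a)"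
proof (coinduction arbitrary: a)
  case cmono
  then show ?case
    by (intro exI[of _ "\<lambda>x. a"] exI[of _ "\<lambda>x. 0"]) auto
qed

text \<open>The derivative of a product is a sum of two products, so the set of products alone is
  not closed under differentiation. Adding finite sums makes it a valid coinduction
  invariant.\<close>

inductive cm_products :: "real \<Rightarrow> (real \<Rightarrow> real) \<Rightarrow> bool" for l where
  "cmono l f \<Longrightarrow> cmono l g \<Longrightarrow> cm_products l (\<lambda>x. f x * g x)"
| "cm_products l f \<Longrightarrow> cm_products l g \<Longrightarrow> cm_products l (\<lambda>x. f x + g x)"

lemma cm_products_deriv:
  assumes "cm_products l h"
  shows "(\<forall>x>l. h x \<ge> 0) \<and>
    (\<exists>k. cm_products l k \<and> (\<forall>x>l. (h has_real_derivative - k x) (at x)))"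
  using assms
proof induction
  case (1 f g)
  obtain k where k: "\<And>x. x > l \<Longrightarrow> f x \<ge> 0"
    "\<And>x. x > l \<Longrightarrow> (f has_real_derivative - k x) (at x)" "cmono l k"
    using cmonoE[OF 1(1)] by metis
  obtain k' where k': "\<And>x. x > l \<Longrightarrow> g x \<ge> 0"
    "\<And>x. x > l \<Longrightarrow> (g has_real_derivative - k' x) (at x)" "cmono l k'"
    using cmonoE[OF 1(2)] by metis
  have "cm_products l (\<lambda>x. k x * g x + f x * k' x)"
    using 1 k k' by (intro cm_products.intros)
  moreover have "((\<lambda>x. f x * g x) has_real_derivative - (k x * g x + f x * k' x)) (at x)"
    if "x > l" for x
    using k(2)[OF that] k'(2)[OF that] by (auto intro!: derivative_eq_intros)
  ultimately show ?case
    using k(1) k'(1) by auto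
next
  case (2 f g)
  then obtain k k' where "cm_products l k" "\<forall>x>l. (f has_real_derivative - k x) (at x)"
    "cm_products l k'" "\<forall>x>l. (g has_real_derivative - k' x) (at x)"
    by auto
  then show ?case
    using 2 by (auto intro!: exI[of _ "\<lambda>x. k x + k' x"] cm_products.intros derivative_eq_intros)
qed

lemma cmono_mult:
  assumes "cmono l f" "cmono l g"
  shows "cmono l (\<lambda>x. f x * g x)"
proof -
  have "cm_products l h \<Longrightarrow> cmono l h" for h
  proof (coinduction arbitrary: h)
    case (cmono h)
    then show ?case
      using cm_products_deriv[OF cmono] by blast
  qed
  then show ?thesis
    using assms by (auto intro: cm_products.intros)
qed

text \<open>The invariant is the family \<open>f * exp (- B)\<close> with \<open>f\<close>
  completely monotone: its negative derivative has the coefficient \<open>k + f * B'\<close>, which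
  is completely monotone again. The sign of \<open>B\<close> itself does not matter.\<close>

lemma cmono_exp_minus:
  assumes B: "\<And>x. x > l \<Longrightarrow> (B has_real_derivative B' x) (at x)" and "cmono l B'"
  shows "cmono l (\<lambda>x. exp (- B x))"
proof -
  have "cmono l f \<Longrightarrow> cmono l (\<lambda>x. f x * exp (- B x))" for f
  proof (coinduction arbitrary: f)
    case (cmono f)
    obtain k where k: "\<And>x. x > l \<Longrightarrow> f x \<ge> 0"
      "\<And>x. x > l \<Longrightarrow> (f has_real_derivative - k x) (at x)" "cmono l k"
      using cmonoE[OF cmono] by metis
    have "((\<lambda>x. f x * exp (- B x)) has_real_derivative - ((k x + f x * B' x) * exp (- B x))) (at x)"
      if "x > l" for x
      using k(2)[OF that] B[OF that] by (auto intro!: derivative_eq_intros simp: algebra_simps)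
    then show ?case
      using k(1) cmono_add[OF k(3) cmono_mult[OF cmono assms(2)]]
      by (intro exI[of _ "\<lambda>x. f x * exp (- B x)"] exI[of _ "\<lambda>x. (k x + f x * B' x) * exp (- B x)"])
        auto
  qed
  from this[OF cmono_const[of 1]] show ?thesis by simp
qed

lemma cmono_affine_powr:
  assumes "\<And>x. x > l \<Longrightarrow> A + B * x > 0" "B \<ge> 0" "q \<ge> 0"
  shows "cmono l (\<lambda>x. (A + B * x) powr - q)"
proof -
  \<comment> \<open>Differentiation multiplies the constant by \<open>B * q\<close> and shifts the
    exponent by one, so the coinduction leaves both free.\<close>
  have "c \<ge> 0 \<Longrightarrow> cmono l (\<lambda>x. c * (A + B * x) powr - q)" for c
    using assms(3)
  proof (coinduction arbitrary: c q)
    case (cmono c q)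
    have "((\<lambda>x. c * (A + B * x) powr - q) has_real_derivative
        - (c * B * q * (A + B * x) powr - (q + 1))) (at x)" if "x > l" for x
      using assms(1)[OF that] by (auto intro!: derivative_eq_intros simp: algebra_simps) (simp add: minus_diff_commute[of 1 q])
    then show ?case
      using cmono assms(2)
      by (intro exI[of _ "\<lambda>x. c * (A + B * x) powr - q"]
        exI[of _ "\<lambda>x. c * B * q * (A + B * x) powr - (q + 1)"]
        conjI disjI1 exI[of _ "c * B * q"] exI[of _ "q + 1"]) auto
  qed
  from this[of 1] show ?thesis by simp
qed

section \<open>Stieltjes transforms\<close>

lemma has_real_derivative_Stieltjes:
  fixes m c :: "'b \<Rightarrow> real"
  assumes m: "\<And>t. m t \<ge> 0" and c: "\<And>t. c t \<ge> - l"
    and [measurable]: "c \<in> borel_measurable M" "m \<in> borel_measurable M"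
    and int: "\<And>w. w > l \<Longrightarrow> integrable M (\<lambda>t. m t / (c t + w))"
    and w: "w > l"
  shows "((\<lambda>w. \<integral>t. m t / (c t + w) ^ Suc n \<partial>M) has_real_derivative
    - (Suc n * (\<integral>t. m t / (c t + w) ^ Suc (Suc n) \<partial>M))) (at w)"
proof -
  \<comment> \<open>As \<open>c t + w\<close> is at least \<open>w - l\<close>, each further power
    in the denominator costs only a constant factor, so integrability of the first power covers all
    of them.\<close>
  have int': "integrable M (\<lambda>t. m t / (c t + w) ^ Suc n)" if "w > l" for w n
  proof (rule Bochner_Integration.integrable_bound)
    show "integrable M (\<lambda>t. m t / (c t + w) / (w - l) ^ n)"
      using int[OF that] by (rule Bochner_Integration.integrable_divide_zero)
    show "AE t in M. norm (m t / (c t + w) ^ Suc n) \<le> norm (m t / (c t + w) / (w - l) ^ n)"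
    proof (intro AE_I2)
      fix t
      have "(w - l) ^ n \<le> (c t + w) ^ n"
        using c[of t] that by (intro power_mono) auto
      then show "norm (m t / (c t + w) ^ Suc n) \<le> norm (m t / (c t + w) / (w - l) ^ n)"
        using m[of t] c[of t] that
        by (auto simp: abs_mult intro!: divide_left_mono mult_left_mono mult_pos_pos)
    qed
  qed measurable
  \<comment> \<open>Half the distance to the end point: for increments below \<open>\<rho>\<close>
    every denominator stays above \<open>\<rho>\<close>, which yields one majorant for all
    difference quotients.\<close>
  define \<rho> where "\<rho> = (w - l) / 2"
  have \<rho>: "\<rho> > 0" using w by (simp add: \<rho>_def)
  define F where "F = (\<lambda>w. \<integral>t. m t / (c t + w) ^ Suc n \<partial>M)"
  define q where "q h t = (m t / (c t + (w + h)) ^ Suc n - m t / (c t + w) ^ Suc n) / h" for h t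
  have bound: "norm (q h t) \<le> Suc n / \<rho> ^ Suc n * (m t / (c t + w))" if "\<bar>h\<bar> < \<rho>" "h \<noteq> 0" for h t
  proof -
    define x y where "x = 1 / (c t + (w + h))" and "y = 1 / (c t + w)"
    have cw: "c t + (w + h) > \<rho>" "c t + w > \<rho>"
      using c[of t] that by (auto simp: \<rho>_def field_simps abs_if split: if_splits)
    have xy: "x > 0" "y > 0" "x \<le> 1 / \<rho>" "y \<le> 1 / \<rho>"
      using cw \<rho> by (auto simp: x_def y_def intro!: divide_left_mono)
    have "x ^ Suc n - y ^ Suc n = (x - y) * (\<Sum>i<Suc n. y ^ (Suc n - Suc i) * x ^ i)"
      by (rule power_diff_sumr2)
    moreover have "x - y = - h * x * y"
      using cw \<rho> by (auto simp: x_def y_def field_simps)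
    ultimately have "(x ^ Suc n - y ^ Suc n) / h = - (x * y * (\<Sum>i<Suc n. y ^ (Suc n - Suc i) * x ^ i))"
      using that by simp
    moreover have "q h t = m t * ((x ^ Suc n - y ^ Suc n) / h)"
      by (simp add: q_def x_def y_def power_one_over field_simps)
    moreover have "0 \<le> x * y * (\<Sum>i<Suc n. y ^ (Suc n - Suc i) * x ^ i)"
      using xy by (intro mult_nonneg_nonneg sum_nonneg) auto
    ultimately have "norm (q h t) = m t * (x * y * (\<Sum>i<Suc n. y ^ (Suc n - Suc i) * x ^ i))"
      using m[of t] by (metis abs_minus_cancel abs_mult abs_of_nonneg mult_minus_right real_norm_def)
    \<comment> \<open>One factor \<open>y\<close> is left unestimated, because it supplies the
      integrable majorant \<open>m t / (c t + w)\<close>.\<close>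
    also have "\<dots> \<le> m t * (1 / \<rho> * y * (\<Sum>i<Suc n. (1 / \<rho>) ^ (Suc n - Suc i) * (1 / \<rho>) ^ i))"
      using xy m[of t] \<rho> by (intro mult_left_mono mult_mono sum_mono power_mono sum_nonneg
        mult_nonneg_nonneg) auto
    also have "(\<Sum>i<Suc n. (1 / \<rho>) ^ (Suc n - Suc i) * (1 / \<rho>) ^ i) = (\<Sum>i<Suc n. (1 / \<rho>) ^ n)"
      by (intro sum.cong) (auto simp flip: power_add)
    finally show ?thesis
      by (simp add: y_def field_simps)
  qed
  have "((\<lambda>h. (F (w + h) - F w) / h) \<longlongrightarrow> - (Suc n * (\<integral>t. m t / (c t + w) ^ Suc (Suc n) \<partial>M))) (at 0)"
    unfolding tendsto_at_iff_sequentially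
  proof (intro allI impI)
    fix X :: "nat \<Rightarrow> real"
    assume X: "\<forall>i. X i \<in> UNIV - {0}" "X \<longlonglongrightarrow> 0"
    have ev: "\<forall>\<^sub>F i in sequentially. \<bar>X i\<bar> < \<rho>"
      using X(2) \<rho> by (auto simp: tendsto_iff dist_real_def)
    then obtain N where N: "\<And>i. i \<ge> N \<Longrightarrow> \<bar>X i\<bar> < \<rho>"
      by (auto simp: eventually_sequentially)
    have "(\<lambda>i. \<integral>t. q (X (i + N)) t \<partial>M) \<longlonglongrightarrow> (\<integral>t. - (Suc n * (m t / (c t + w) ^ Suc (Suc n))) \<partial>M)"
    proof (rule integral_dominated_convergence)
      show "integrable M (\<lambda>t. Suc n / \<rho> ^ Suc n * (m t / (c t + w)))"
        using int[OF w] by (rule Bochner_Integration.integrable_mult_right)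
      show "AE t in M. norm (q (X (i + N)) t) \<le> Suc n / \<rho> ^ Suc n * (m t / (c t + w))" for i
        using N X(1) by (intro AE_I2 bound) auto
      show "AE t in M. (\<lambda>i. q (X (i + N)) t) \<longlonglongrightarrow> - (Suc n * (m t / (c t + w) ^ Suc (Suc n)))"
      proof (intro AE_I2)
        fix t
        have "c t + w > 0"
          using c[of t] w by auto
        then have W: "c t + w \<noteq> 0" by simp
        have "((\<lambda>w. (c t + w) ^ Suc n) has_real_derivative (1 + real n) * ((0 + 1) * (c t + w) ^ n)) (at w)"
          by (intro DERIV_power_Suc DERIV_add DERIV_const DERIV_ident)
        then have "((\<lambda>w. m t / (c t + w) ^ Suc n) has_real_derivative
            (0 * (c t + w) ^ Suc n - m t * ((1 + real n) * ((0 + 1) * (c t + w) ^ n))) /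
            ((c t + w) ^ Suc n * (c t + w) ^ Suc n)) (at w)"
          using W by (intro DERIV_divide DERIV_const) auto
        also have "(0 * (c t + w) ^ Suc n - m t * ((1 + real n) * ((0 + 1) * (c t + w) ^ n))) /
            ((c t + w) ^ Suc n * (c t + w) ^ Suc n) = - (Suc n * (m t / (c t + w) ^ Suc (Suc n)))"
        proof -
          have "(0 * W ^ Suc n - a * (k * ((0 + 1) * W ^ n))) / (W ^ Suc n * W ^ Suc n) =
              - (k * (a / W ^ Suc (Suc n)))" if "W \<noteq> 0" for W a k :: real
            using that by (simp add: field_simps)
          from this[OF W, of "m t" "1 + real n"] show ?thesis by simp
        qed
        finally have "((\<lambda>w. m t / (c t + w) ^ Suc n) has_real_derivative
            - (Suc n * (m t / (c t + w) ^ Suc (Suc n)))) (at w)" .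
        then have "((\<lambda>h. q h t) \<longlongrightarrow> - (Suc n * (m t / (c t + w) ^ Suc (Suc n)))) (at 0)"
          by (simp add: DERIV_def q_def add.assoc)
        moreover have "filterlim (\<lambda>i. X (i + N)) (at 0) sequentially"
          using X LIMSEQ_ignore_initial_segment[OF X(2)] by (intro filterlim_atI) auto
        ultimately show "(\<lambda>i. q (X (i + N)) t) \<longlonglongrightarrow> - (Suc n * (m t / (c t + w) ^ Suc (Suc n)))"
          by (rule filterlim_compose)
      qed
    qed (simp_all add: q_def)
    moreover have "(\<integral>t. q (X (i + N)) t \<partial>M) = (F (w + X (i + N)) - F w) / X (i + N)" for i
    proof -
      have "w + X (i + N) > l"
        using N[of "i + N"] by (auto simp: \<rho>_def abs_if field_simps split: if_splits)
      then show ?thesis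
        unfolding q_def F_def
        using int'[OF w] int' by (simp del: power_Suc add: Bochner_Integration.integral_diff)
    qed
    ultimately have "(\<lambda>i. (F (w + X (i + N)) - F w) / X (i + N)) \<longlonglongrightarrow>
        - (Suc n * (\<integral>t. m t / (c t + w) ^ Suc (Suc n) \<partial>M))"
      by (simp only: Bochner_Integration.integral_minus integral_mult_right_zero)
    from LIMSEQ_offset[OF this]
    show "((\<lambda>h. (F (w + h) - F w) / h) \<circ> X) \<longlonglongrightarrow> - (Suc n * (\<integral>t. m t / (c t + w) ^ Suc (Suc n) \<partial>M))"
      by (simp add: o_def)
  qed
  then show ?thesis
    by (simp add: DERIV_def F_def)
qed

text \<open>Each derivative is an integral of the same kind with the next power in the denominator,
  so nonnegative multiples of all these integrals form a family closed under negated
  differentiation.\<close>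

lemma cmono_Stieltjes:
  fixes m c :: "'b \<Rightarrow> real"
  assumes m: "\<And>t. m t \<ge> 0" and c: "\<And>t. c t \<ge> - l"
    and meas: "c \<in> borel_measurable M" "m \<in> borel_measurable M"
    and int: "\<And>w. w > l \<Longrightarrow> integrable M (\<lambda>t. m t / (c t + w))"
  shows "cmono l (\<lambda>w. \<integral>t. m t / (c t + w) \<partial>M)"
proof -
  have "a \<ge> 0 \<Longrightarrow> cmono l (\<lambda>w. a * (\<integral>t. m t / (c t + w) ^ Suc n \<partial>M))" for a n
  proof (coinduction arbitrary: a n)
    case (cmono a n)
    let ?F = "\<lambda>n w. \<integral>t. m t / (c t + w) ^ Suc n \<partial>M"
    have "((\<lambda>w. a * ?F n w) has_real_derivative - ((a * Suc n) * ?F (Suc n) w)) (at w)"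
      if "w > l" for w
      using DERIV_cmult[OF has_real_derivative_Stieltjes[OF m c meas int that], of a n]
      by (simp add: mult.assoc)
    moreover have "a * ?F n w \<ge> 0" if "w > l" for w
    proof -
      have "c t + w > 0" for t
        using c[of t] that by auto
      then have "0 \<le> m t / (c t + w) ^ Suc n" for t
        using m[of t] less_imp_le by (intro divide_nonneg_nonneg zero_le_power) auto
      then show ?thesis
        using cmono by (intro mult_nonneg_nonneg integral_nonneg_AE AE_I2)
    qed
    ultimately show ?case
      using cmono by (intro exI[of _ "\<lambda>w. a * ?F n w"] exI[of _ "\<lambda>w. (a * Suc n) * ?F (Suc n) w"]
        conjI disjI1 exI[of _ "a * Suc n"] exI[of _ "Suc n"]) auto
  qed
  from this[of 1 0] show ?thesis by simp
qed

section \<open>The Stieltjes representation of the logarithmic derivative\<close>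

text \<open>Both terms of the kernel below have a simple pole with residue 1 at the origin; hence
  the singularity of their difference is removable.\<close>

lemma exp_minus_one_div_tendsto:
  fixes c :: complex
  assumes "c \<noteq> 0"
  shows "((\<lambda>s. s * (c / (1 - exp (- c * s)))) \<longlongrightarrow> 1) (at 0)"
proof -
  have "((\<lambda>s. 1 - exp (- c * s)) has_field_derivative c) (at 0)"
    by (auto intro!: derivative_eq_intros)
  then have "((\<lambda>s. (1 - exp (- c * s)) / s) \<longlongrightarrow> c) (at 0)"
    by (simp add: has_field_derivative_iff)
  then have "((\<lambda>s. c / ((1 - exp (- c * s)) / s)) \<longlongrightarrow> c / c) (at 0)"
    using assms by (intro tendsto_intros)
  then show ?thesis
    using assms by (simp add: mult.commute)
qed

lemma exp_real_mult_eq_1_iff: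
  assumes "c > 0"
  shows "exp (- of_real c * s) = (1::complex) \<longleftrightarrow> (\<exists>k::int. s = of_real (2 * pi * k / c) * \<i>)"
proof -
  have "exp (- of_real c * s) = 1 \<longleftrightarrow> exp (of_real c * s) = 1"
    by (simp add: exp_minus)
  also have "\<dots> \<longleftrightarrow> (Re s = 0 \<and> (\<exists>k::int. c * Im s = of_int (2 * k) * pi))"
    using assms by (simp add: exp_eq_1)
  also have "\<dots> \<longleftrightarrow> (\<exists>k::int. s = of_real (2 * pi * k / c) * \<i>)"
    using assms by (auto simp: complex_eq_iff field_simps)
  finally show ?thesis .
qed

lemma exp_real_mult_eq_1_strip:
  assumes "c > 0" "\<bar>Im s\<bar> < 2 * pi / c" "exp (- of_real c * s) = (1::complex)"
  shows "s = 0"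
proof -
  obtain k :: int where k: "s = of_real (2 * pi * k / c) * \<i>"
    using exp_real_mult_eq_1_iff[OF assms(1)] assms(3) by blast
  have "\<bar>2 * pi * k / c\<bar> = (2 * pi / c) * \<bar>k\<bar>"
    using assms(1) by (simp add: abs_mult)
  moreover have "\<bar>2 * pi * k / c\<bar> < 2 * pi / c"
    using assms(2) k by simp
  ultimately have "(2 * pi / c) * \<bar>real_of_int k\<bar> < (2 * pi / c) * 1"
    by simp
  moreover have "2 * pi / c > 0" using assms(1) by simp
  ultimately have "\<bar>real_of_int k\<bar> < 1"
    using mult_less_cancel_left_pos by blast
  then have "k = 0" by linarith
  then show ?thesis using k by simp
qed

text \<open>
  In the variable \<open>s = Ln \<zeta>\<close> this is \<open>\<zeta>\<close> times the logarithmic derivative of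
  \<open>(\<zeta> powr \<alpha> - 1) / (\<zeta> - 1)\<close>.
\<close>

definition log_deriv_kernel :: "real \<Rightarrow> complex \<Rightarrow> complex" where
  "log_deriv_kernel \<alpha> s = \<alpha> / (1 - exp (- \<alpha> * s)) - 1 / (1 - exp (- s))"

text \<open>The poles lie at multiples of 2 pi i and 2 pi i / \<alpha>. For \<alpha> < 2 the nonzero
  ones have imaginary part beyond pi, which leaves room for an open strip around the horizontal
  sides of the contour. The bound \<open>r < 2 * pi\<close> later ensures that
  \<open>exp s = exp x\<close> has only one solution in the strip.\<close>

lemma log_deriv_kernel_extend:
  assumes "0 < \<alpha>" "\<alpha> < 2"
  obtains g r where "r > pi" "r < 2 * pi" "g holomorphic_on {s. \<bar>Im s\<bar> < r}"
    "\<And>s. \<bar>Im s\<bar> < r \<Longrightarrow> s \<noteq> 0 \<Longrightarrow> g s = log_deriv_kernel \<alpha> s"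
proof -
  define r0 where "r0 = min (2 * pi) (2 * pi / \<alpha>)"
  have "r0 > pi"
    using assms by (auto simp: r0_def field_simps)
  then obtain r where r: "pi < r" "r < r0"
    using dense by blast
  define S where "S = {s. \<bar>Im s\<bar> < r}"
  have S: "open S"
    unfolding S_def by (intro open_Collect_less continuous_intros)
  have "exp (- complex_of_real \<alpha> * s) \<noteq> 1" "exp (- s) \<noteq> 1" if "s \<in> S" "s \<noteq> 0" for s
    using exp_real_mult_eq_1_strip[of \<alpha> s] exp_real_mult_eq_1_strip[of 1 s] that r assms
    by (auto simp: S_def r0_def)
  then have holo: "log_deriv_kernel \<alpha> holomorphic_on S - {0}"
    unfolding log_deriv_kernel_def by (intro holomorphic_intros) auto
  have "((\<lambda>s::complex. s * (of_real \<alpha> / (1 - exp (- of_real \<alpha> * s))) - s * (1 / (1 - exp (- 1 * s)))) \<longlongrightarrow> 1 - 1) (at 0)"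
    using exp_minus_one_div_tendsto[of "of_real \<alpha>"] exp_minus_one_div_tendsto[of 1] assms
    by (intro tendsto_diff) simp_all
  then have "((\<lambda>s. (s - 0) * log_deriv_kernel \<alpha> s) \<longlongrightarrow> 0) (at 0)"
    by (simp add: log_deriv_kernel_def right_diff_distrib)
  moreover have "0 \<in> interior S"
  proof -
    have "r > 0" using r pi_gt_zero by linarith
    then show ?thesis using S by (simp add: interior_open) (simp add: S_def)
  qed
  ultimately obtain g where "g holomorphic_on S" "\<forall>s\<in>S - {0}. g s = log_deriv_kernel \<alpha> s"
    using holomorphic_on_extend_lim[OF holo] by blast
  then show thesis
    using that[of r g] r by (auto simp: S_def r0_def)
qed

lemma Im_inverse_one_minus_exp:
  "Im (1 / (1 - exp (- of_real a * (of_real t + \<i> * pi)))) =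
    - sin (pi * a) / (2 * (cosh (a * t) - cos (pi * a)))"
proof -
  define E where "E = exp (- a * t)"
  have E: "E > 0" by (simp add: E_def)
  have w: "exp (- of_real a * (of_real t + \<i> * pi)) = of_real E * cis (- (pi * a))"
    by (simp add: E_def exp_of_real[symmetric] cis_conv_exp exp_add[symmetric] algebra_simps)
  have "Im (1 / (1 - of_real E * cis (- (pi * a)))) =
    - E * sin (pi * a) / ((1 - E * cos (pi * a))\<^sup>2 + (E * sin (pi * a))\<^sup>2)"
    by (simp add: Im_divide)
  also have "(1 - E * cos (pi * a))\<^sup>2 + (E * sin (pi * a))\<^sup>2 =
      1 - 2 * E * cos (pi * a) + E\<^sup>2 * ((sin (pi * a))\<^sup>2 + (cos (pi * a))\<^sup>2)"
    by algebra
  also have "\<dots> = 2 * E * (cosh (a * t) - cos (pi * a))"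
    using E by (simp add: cosh_def E_def exp_minus power2_eq_square field_simps)
  finally show ?thesis
    unfolding w using E by simp
qed

text \<open>The jump of the kernel across the cut, divided by 2 pi i, at \<zeta> = - exp t. The term
  with \<open>1 - exp (- s)\<close> is real on the line of imaginary part pi, so only the term with
  \<alpha> contributes.\<close>

definition stieltjes_weight :: "real \<Rightarrow> real \<Rightarrow> real" where
  "stieltjes_weight \<alpha> t = - \<alpha> * sin (pi * \<alpha>) / (2 * pi * (cosh (\<alpha> * t) - cos (pi * \<alpha>)))"

lemma stieltjes_weight_denominator_pos:
  assumes "0 < \<alpha>" "\<alpha> < 2"
  shows "cosh (\<alpha> * t) - cos (pi * \<alpha>) > 0"
proof -
  have "cos (pi * \<alpha>) \<noteq> 1"
  proof
    assume "cos (pi * \<alpha>) = 1"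
    then obtain k :: int where k: "pi * \<alpha> = of_int k * 2 * pi"
      by (auto simp: cos_one_2pi_int)
    then have "\<alpha> = 2 * k" by simp
    with assms have "0 < k" "k < 1" by linarith+
    then show False by simp
  qed
  then have "cos (pi * \<alpha>) < 1"
    using cos_le_one[of "pi * \<alpha>"] by linarith
  then show ?thesis
    using cosh_real_ge_1[of "\<alpha> * t"] by linarith
qed

lemma continuous_on_stieltjes_weight:
  assumes "0 < \<alpha>" "\<alpha> < 2"
  shows "continuous_on X (stieltjes_weight \<alpha>)"
proof -
  have "2 * pi * (cosh (\<alpha> * t) - cos (pi * \<alpha>)) \<noteq> 0" for t
    using stieltjes_weight_denominator_pos[OF assms, of t] by simp
  then show ?thesis
    unfolding stieltjes_weight_def by (intro continuous_intros) auto
qed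

lemma Im_log_deriv_kernel:
  "Im (log_deriv_kernel \<alpha> (of_real t + \<i> * pi)) = pi * stieltjes_weight \<alpha> t"
proof -
  have "Im (log_deriv_kernel \<alpha> (of_real t + \<i> * pi)) =
      \<alpha> * Im (1 / (1 - exp (- of_real \<alpha> * (of_real t + \<i> * pi)))) -
      Im (1 / (1 - exp (- of_real 1 * (of_real t + \<i> * pi))))"
    by (simp add: log_deriv_kernel_def Im_divide)
  also have "\<dots> = pi * stieltjes_weight \<alpha> t"
    unfolding Im_inverse_one_minus_exp by (simp add: stieltjes_weight_def)
  finally show ?thesis .
qed

lemma log_deriv_kernel_cnj: "log_deriv_kernel \<alpha> (cnj s) = cnj (log_deriv_kernel \<alpha> s)"
  by (simp add: log_deriv_kernel_def exp_cnj)

section \<open>The rectangular contour integral\<close>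

lemma contour_integral_linepath_horizontal:
  assumes "a < b"
  shows "contour_integral (linepath (Complex a c) (Complex b c)) f = integral {a..b} (\<lambda>t. f (Complex t c))"
proof -
  have *: "linepath (Complex a c) (Complex b c) = (+) (\<i> * c) \<circ> linepath (of_real a) (of_real b)"
    by (auto simp: linepath_def complex_eq_iff algebra_simps)
  have "contour_integral (linepath (of_real a) (of_real b)) (\<lambda>z. f (z + \<i> * c)) =
      integral {a..b} (\<lambda>t. f (Complex t c))"
    using contour_integral_linepath_Reals_eq[of "of_real a" "of_real b"] assms
    by (simp add: Complex_eq)
  then show ?thesis
    unfolding * contour_integral_translate .
qed

text \<open>The horizontal sides are paired in one integral because their difference will be the
  jump across the cut; the vertical sides stay separate because they will tend to 0.\<close>

lemma contour_integral_rectpath_symmetric: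
  assumes "R > 0" "c > 0"
    and cont: "continuous_on (path_image (rectpath (Complex (-R) (-c)) (Complex R c))) f"
  shows "contour_integral (rectpath (Complex (-R) (-c)) (Complex R c)) f =
    integral {-R..R} (\<lambda>t. f (Complex t (-c)) - f (Complex t c)) +
    contour_integral (linepath (Complex R (-c)) (Complex R c)) f -
    contour_integral (linepath (Complex (-R) (-c)) (Complex (-R) c)) f"
proof -
  let ?a = "Complex (-R) (-c)" and ?b = "Complex R (-c)" and ?c = "Complex R c" and ?d = "Complex (-R) c"
  have P: "path_image (rectpath ?a ?c) = closed_segment ?a ?b \<union> closed_segment ?b ?c \<union>
      closed_segment ?c ?d \<union> closed_segment ?d ?a"
    by (simp add: rectpath_def Let_def path_image_join Un_assoc)
  have int: "f contour_integrable_on (linepath ?a ?b)" "f contour_integrable_on (linepath ?b ?c)"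
    "f contour_integrable_on (linepath ?c ?d)" "f contour_integrable_on (linepath ?d ?a)"
    using cont unfolding P
    by (auto intro!: contour_integrable_continuous_linepath elim: continuous_on_subset)
  have hor: "(\<lambda>t. f (Complex t e)) integrable_on {-R..R}" if "\<bar>e\<bar> = c" for e
  proof (intro integrable_continuous_real continuous_on_compose2[OF cont])
    show "continuous_on {-R..R} (\<lambda>t. Complex t e)"
      by (intro continuous_intros)
    show "(\<lambda>t. Complex t e) ` {-R..R} \<subseteq> path_image (rectpath ?a ?c)"
      using that assms by (subst path_image_rectpath) auto
  qed
  have "contour_integral (rectpath ?a ?c) f = contour_integral (linepath ?a ?b) f +
      contour_integral (linepath ?b ?c) f + contour_integral (linepath ?c ?d) f +
      contour_integral (linepath ?d ?a) f"
    using int by (simp add: rectpath_def Let_def contour_integrable_joinI)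
  also have "contour_integral (linepath ?c ?d) f = - contour_integral (linepath ?d ?c) f"
    by (rule contour_integral_reverse_linepath)
      (use cont in \<open>auto simp: P closed_segment_commute elim: continuous_on_subset\<close>)
  also have "contour_integral (linepath ?d ?a) f = - contour_integral (linepath ?a ?d) f"
    by (rule contour_integral_reverse_linepath)
      (use cont in \<open>auto simp: P closed_segment_commute elim: continuous_on_subset\<close>)
  finally show ?thesis
    using assms hor[of c] hor[of "-c"]
    by (simp add: contour_integral_linepath_horizontal Henstock_Kurzweil_Integration.integral_diff)
qed

lemma log_deriv_kernel_bound_right:
  assumes "\<alpha> > 0" "exp (- \<alpha> * Re s) \<le> 1 / 2" "exp (- Re s) \<le> 1 / 2"
  shows "norm (log_deriv_kernel \<alpha> s) \<le> 2 * \<alpha> + 2"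
proof -
  have *: "norm (of_real c / (1 - z)) \<le> c * 2" if "norm z \<le> 1 / 2" "c > 0" for z :: complex and c :: real
  proof -
    have "norm (1 - z) \<ge> 1 / 2"
      using norm_triangle_ineq2[of 1 z] that by simp
    then have "c / norm (1 - z) \<le> c / (1 / 2)"
      using that by (intro divide_left_mono) auto
    then show ?thesis
      using that by (simp add: norm_divide)
  qed
  have "norm (log_deriv_kernel \<alpha> s) \<le> norm (of_real \<alpha> / (1 - exp (- of_real \<alpha> * s))) + norm (of_real 1 / (1 - exp (- s)))"
    unfolding log_deriv_kernel_def using norm_triangle_ineq4 by fastforce
  also have "\<dots> \<le> \<alpha> * 2 + 1 * 2"
    using assms by (intro add_mono *) auto
  finally show ?thesis by simp
qed

text \<open>On the right vertical side a bounded kernel suffices, as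
  \<open>1 / (exp s - exp x)\<close> decays. On the left side that factor tends to a nonzero
  constant, so the kernel itself has to provide the decay.\<close>

lemma log_deriv_kernel_bound_left:
  assumes "\<alpha> > 0" "exp (- \<alpha> * Re s) > 1" "exp (- Re s) > 1"
  shows "norm (log_deriv_kernel \<alpha> s) \<le> \<alpha> / (exp (- \<alpha> * Re s) - 1) + 1 / (exp (- Re s) - 1)"
proof -
  have *: "norm (of_real c / (1 - z)) \<le> c / (norm z - 1)" if "norm z > 1" "c > 0" for z :: complex and c :: real
  proof -
    have "norm (1 - z) \<ge> norm z - 1"
      using norm_triangle_ineq2[of z 1] by (simp add: norm_minus_commute)
    then have "c / norm (1 - z) \<le> c / (norm z - 1)"
      using that by (intro divide_left_mono mult_pos_pos) auto
    then show ?thesis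
      using that by (simp add: norm_divide)
  qed
  have "norm (log_deriv_kernel \<alpha> s) \<le> norm (of_real \<alpha> / (1 - exp (- of_real \<alpha> * s))) + norm (of_real 1 / (1 - exp (- s)))"
    unfolding log_deriv_kernel_def using norm_triangle_ineq4 by fastforce
  also have "\<dots> \<le> \<alpha> / (norm (exp (- of_real \<alpha> * s)) - 1) + 1 / (norm (exp (- s)) - 1)"
    using assms by (intro add_mono *) auto
  finally show ?thesis by simp
qed

text \<open>Residue theorem for the kernel divided by \<open>exp s - exp x\<close>, whose only pole
  in the strip is \<open>x\<close>. On the two horizontal sides \<open>exp\<close> takes the same
  value \<open>- exp t\<close> and the kernel takes conjugate values, so their difference is 2 i
  times an imaginary part. For nonzero \<open>x\<close> the extended kernel in the residue is given
  by its formula.\<close>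

lemma stieltjes_integral_tendsto:
  assumes \<alpha>: "0 < \<alpha>" "\<alpha> < 2" and "x \<noteq> 0"
  shows "((\<lambda>R. integral {-R..R} (\<lambda>t. stieltjes_weight \<alpha> t / (exp t + exp x))) \<longlongrightarrow>
    (\<alpha> / (1 - exp (- \<alpha> * x)) - 1 / (1 - exp (- x))) / exp x) at_top"
proof -
  obtain g r where gr: "r > pi" "r < 2 * pi" "g holomorphic_on {s. \<bar>Im s\<bar> < r}"
    "\<And>s. \<bar>Im s\<bar> < r \<Longrightarrow> s \<noteq> 0 \<Longrightarrow> g s = log_deriv_kernel \<alpha> s"
    using log_deriv_kernel_extend[OF \<alpha>] by blast
  define S where "S = {s. \<bar>Im s\<bar> < r}"
  have S: "open S" "convex S"
  proof -
    show "open S"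
      unfolding S_def by (intro open_Collect_less continuous_intros)
    have "S = {s. Im s < r} \<inter> {s. Im s > - r}"
      by (auto simp: S_def)
    then show "convex S"
      by (simp add: convex_Int convex_halfspace_Im_lt convex_halfspace_Im_gt)
  qed
  define A where "A s = g s / (exp s - exp (of_real x))" for s
  have "exp s \<noteq> exp (of_real x)" if "s \<in> S" "s \<noteq> of_real x" for s :: complex
  proof
    assume "exp s = exp (of_real x)"
    then have "exp (- of_real 1 * (of_real x - s)) = 1"
      by (simp add: exp_diff)
    then show False
      using exp_real_mult_eq_1_strip[of 1 "of_real x - s"] that gr by (auto simp: S_def)
  qed
  then have holo: "A holomorphic_on S - {of_real x}"
    unfolding A_def using gr(3) by (intro holomorphic_intros) (auto simp: S_def elim: holomorphic_on_subset)
  have xS: "of_real x \<in> S" using gr pi_gt_zero by (simp add: S_def)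
  have res: "residue A (of_real x) = g (of_real x) / exp (of_real x)"
  proof (rule residue_simple'[OF S(1) xS holo])
    have "(exp has_field_derivative exp (of_real x)) (at (complex_of_real x))"
      by (rule DERIV_exp)
    then have "((\<lambda>s. (exp s - exp (of_real x)) / (s - complex_of_real x)) \<longlongrightarrow> exp (of_real x)) (at (of_real x))"
      by (simp add: has_field_derivative_iff)
    moreover have "(g \<longlongrightarrow> g (of_real x)) (at (of_real x))"
    proof -
      have "continuous_on S g"
        using gr(3) unfolding S_def by (rule holomorphic_on_imp_continuous_on)
      then have "isCont g (of_real x)"
        using S(1) xS by (simp add: continuous_on_eq_continuous_at)
      then show ?thesis by (rule isContD)
    qed
    ultimately have "((\<lambda>s. g s / ((exp s - exp (of_real x)) / (s - complex_of_real x))) \<longlongrightarrow>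
        g (of_real x) / exp (of_real x)) (at (of_real x))"
      by (intro tendsto_divide) auto
    then show "((\<lambda>w. A w * (w - of_real x)) \<longlongrightarrow> g (of_real x) / exp (of_real x)) (at (of_real x))"
      by (simp add: A_def)
  qed
  define V where "V R = contour_integral (linepath (Complex R (-pi)) (Complex R pi)) A" for R
  define I where "I R = integral {-R..R} (\<lambda>t. stieltjes_weight \<alpha> t / (exp t + exp x))" for R
  have main: "2 * pi * \<i> * of_real (I R) + V R - V (-R) = 2 * pi * \<i> * (g (of_real x) / exp (of_real x))"
    if R: "R > \<bar>x\<bar>" for R
  proof -
    let ?p = "rectpath (Complex (-R) (-pi)) (Complex R pi)"
    have R0: "R > 0" using R by simp
    have pim: "path_image ?p \<subseteq> S - {of_real x}"
      using R R0 gr(1) by (subst path_image_rectpath) (auto simp: S_def)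
    have "contour_integral ?p A = 2 * pi * \<i> * (\<Sum>p\<in>{of_real x}. winding_number ?p p * residue A p)"
    proof (rule Residue_theorem[OF S(1) convex_connected[OF S(2)] _ holo _ _ pim])
      show "\<forall>z. z \<notin> S \<longrightarrow> winding_number ?p z = 0"
        using gr(1) R0 by (auto intro!: winding_number_rectpath_outside simp: S_def in_cbox_complex_iff)
    qed auto
    moreover have "winding_number ?p (of_real x) = 1"
      using R by (intro winding_number_rectpath) (auto simp: in_box_complex_iff)
    moreover have "contour_integral ?p A = integral {-R..R} (\<lambda>t. A (Complex t (-pi)) - A (Complex t pi)) + V R - V (-R)"
      unfolding V_def using R0
      by (subst contour_integral_rectpath_symmetric)
        (auto intro: continuous_on_subset[OF holomorphic_on_imp_continuous_on[OF holo] pim])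
    moreover have "integral {-R..R} (\<lambda>t. A (Complex t (-pi)) - A (Complex t pi)) =
        integral {-R..R} (\<lambda>t. 2 * pi * \<i> * of_real (stieltjes_weight \<alpha> t / (exp t + exp x)))"
    proof (rule Henstock_Kurzweil_Integration.integral_cong)
      fix t
      have e: "exp (Complex t pi) = - of_real (exp t)" "exp (Complex t (-pi)) = - of_real (exp t)"
        by (simp_all add: complex_eq_iff Re_exp Im_exp)
      have k: "g (Complex t pi) = log_deriv_kernel \<alpha> (Complex t pi)"
        "g (Complex t (-pi)) = log_deriv_kernel \<alpha> (Complex t (-pi))"
        using gr pi_gt_zero by (auto simp: complex_eq_iff)
      have k': "log_deriv_kernel \<alpha> (Complex t (-pi)) = cnj (log_deriv_kernel \<alpha> (Complex t pi))"
      proof -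
        have "Complex t (-pi) = cnj (Complex t pi)" by (simp add: complex_eq_iff)
        then show ?thesis by (simp only: log_deriv_kernel_cnj)
      qed
      have im: "Im (log_deriv_kernel \<alpha> (Complex t pi)) = pi * stieltjes_weight \<alpha> t"
        using Im_log_deriv_kernel[of \<alpha> t] by (simp add: Complex_eq)
      have d: "- of_real (exp t) - exp (of_real x) = - complex_of_real (exp t + exp x)"
        by (simp add: exp_of_real)
      have "a / - W - b / - W = (b - a) / W" for a b W :: complex
        by (simp add: diff_divide_distrib)
      then have "A (Complex t (-pi)) - A (Complex t pi) =
        (log_deriv_kernel \<alpha> (Complex t pi) - cnj (log_deriv_kernel \<alpha> (Complex t pi))) / of_real (exp t + exp x)"
        unfolding A_def e k k' d .
      also have "\<dots> = 2 * pi * \<i> * of_real (stieltjes_weight \<alpha> t / (exp t + exp x))"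
        by (simp add: complex_diff_cnj im)
      finally show "A (Complex t (-pi)) - A (Complex t pi) = 2 * pi * \<i> * of_real (stieltjes_weight \<alpha> t / (exp t + exp x))" .
    qed
    moreover have "integral {-R..R} (\<lambda>t. 2 * pi * \<i> * of_real (stieltjes_weight \<alpha> t / (exp t + exp x))) =
        2 * pi * \<i> * of_real (I R)"
    proof -
      have "exp t + exp x \<noteq> 0" for t
        by (smt (verit) exp_gt_zero)
      then have "((\<lambda>t. stieltjes_weight \<alpha> t / (exp t + exp x)) has_integral I R) {-R..R}"
        unfolding I_def
        by (intro integrable_integral integrable_continuous_real continuous_intros
          continuous_on_stieltjes_weight \<alpha>) auto
      from has_integral_linear[OF this bounded_linear_of_real[where 'a=complex]]
      have "((\<lambda>t. of_real (stieltjes_weight \<alpha> t / (exp t + exp x))) has_integral complex_of_real (I R)) {-R..R}"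
        by (simp add: o_def)
      then show ?thesis
        by (intro integral_unique has_integral_mult_right)
    qed
    ultimately show ?thesis
      using res by simp
  qed
  have V: "norm (V R) \<le> K / \<bar>exp R - exp x\<bar> * (2 * pi)"
    if "R \<noteq> 0" "R \<noteq> x" and K: "\<And>y. norm (log_deriv_kernel \<alpha> (Complex R y)) \<le> K" for R K
  proof -
    have seg: "closed_segment (Complex R (-pi)) (Complex R pi) \<subseteq> S - {of_real x}"
      using that(2) gr(1) by (auto simp: closed_segment_same_Re closed_segment_eq_real_ivl S_def)
    have K0: "0 \<le> K" using K[of 0] norm_ge_zero order_trans by blast
    have "norm (V R) \<le> K / \<bar>exp R - exp x\<bar> * norm (Complex R pi - Complex R (-pi))"
      unfolding V_def
    proof (rule contour_integral_bound_linepath)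
      show "A contour_integrable_on linepath (Complex R (- pi)) (Complex R pi)"
        by (intro contour_integrable_continuous_linepath
          continuous_on_subset[OF holomorphic_on_imp_continuous_on[OF holo] seg])
      show "0 \<le> K / \<bar>exp R - exp x\<bar>" using K0 by simp
      fix s assume "s \<in> closed_segment (Complex R (-pi)) (Complex R pi)"
      then have s: "Re s = R" "\<bar>Im s\<bar> \<le> pi"
        by (auto simp: closed_segment_same_Re closed_segment_eq_real_ivl)
      have "g s = log_deriv_kernel \<alpha> s"
        using s gr(1) that(1) by (intro gr(4)) auto
      then have "norm (g s) \<le> K"
        using K[of "Im s"] s by (simp add: complex_eq_iff) (metis complex_surj)
      moreover have "\<bar>exp R - exp x\<bar> \<le> norm (exp s - exp (of_real x))"
        using norm_triangle_ineq3[of "exp s" "exp (of_real x)"] s by simp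
      moreover have "\<bar>exp R - exp x\<bar> > 0" using that(2) by simp
      ultimately show "norm (A s) \<le> K / \<bar>exp R - exp x\<bar>"
        using K0 unfolding A_def norm_divide by (intro frac_le) auto
    qed
    also have "Complex R pi - Complex R (-pi) = of_real (2 * pi) * \<i>"
      by (simp add: complex_eq_iff)
    finally show ?thesis by (simp add: norm_mult)
  qed
  have V1: "(V \<longlongrightarrow> 0) at_top"
  proof (rule Lim_null_comparison)
    have "eventually (\<lambda>R. exp (- \<alpha> * R) \<le> 1 / 2) at_top" "eventually (\<lambda>R::real. exp (- R) \<le> 1 / 2) at_top"
      using \<alpha> by real_asymp+
    then show "\<forall>\<^sub>F R in at_top. norm (V R) \<le> (2 * \<alpha> + 2) / \<bar>exp R - exp x\<bar> * (2 * pi)"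
      using eventually_gt_at_top[of 0] eventually_gt_at_top[of x]
    proof eventually_elim
      case (elim R)
      then show ?case
        using \<alpha> by (intro V log_deriv_kernel_bound_right) auto
    qed
    show "((\<lambda>R. (2 * \<alpha> + 2) / \<bar>exp R - exp x\<bar> * (2 * pi)) \<longlongrightarrow> 0) at_top"
      by real_asymp
  qed
  have V2: "((\<lambda>R. V (-R)) \<longlongrightarrow> 0) at_top"
  proof (rule Lim_null_comparison)
    show "\<forall>\<^sub>F R in at_top. norm (V (-R)) \<le> (\<alpha> / (exp (\<alpha> * R) - 1) + 1 / (exp R - 1)) / \<bar>exp (- R) - exp x\<bar> * (2 * pi)"
      using eventually_gt_at_top[of 0] eventually_gt_at_top[of "-x"]
    proof eventually_elim
      case (elim R)
      have "norm (log_deriv_kernel \<alpha> (Complex (-R) y)) \<le> \<alpha> / (exp (\<alpha> * R) - 1) + 1 / (exp R - 1)" for y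
        using log_deriv_kernel_bound_left[of \<alpha> "Complex (-R) y"] \<alpha> elim by simp
      then show ?case
        using elim by (intro V) auto
    qed
    show "((\<lambda>R. (\<alpha> / (exp (\<alpha> * R) - 1) + 1 / (exp R - 1)) / \<bar>exp (- R) - exp x\<bar> * (2 * pi)) \<longlongrightarrow> 0) at_top"
    proof -
      have "((\<lambda>R. \<alpha> / (exp (\<alpha> * R) - 1)) \<longlongrightarrow> 0) at_top" "((\<lambda>R::real. 1 / (exp R - 1)) \<longlongrightarrow> 0) at_top"
        "((\<lambda>R::real. exp (- R)) \<longlongrightarrow> 0) at_top"
        using \<alpha> by real_asymp+
      then have "((\<lambda>R. (\<alpha> / (exp (\<alpha> * R) - 1) + 1 / (exp R - 1)) / \<bar>exp (- R) - exp x\<bar> * (2 * pi)) \<longlongrightarrow>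
          (0 + 0) / \<bar>0 - exp x\<bar> * (2 * pi)) at_top"
        by (intro tendsto_intros) auto
      then show ?thesis by simp
    qed
  qed
  have "((\<lambda>R. (2 * pi * \<i> * (g (of_real x) / exp (of_real x)) - V R + V (-R)) / (2 * pi * \<i>)) \<longlongrightarrow>
     (2 * pi * \<i> * (g (of_real x) / exp (of_real x)) - 0 + 0) / (2 * pi * \<i>)) at_top"
    using V1 V2 by (intro tendsto_intros) auto
  moreover have "\<forall>\<^sub>F R in at_top. (2 * pi * \<i> * (g (of_real x) / exp (of_real x)) - V R + V (-R)) / (2 * pi * \<i>) = of_real (I R)"
    using eventually_gt_at_top[of "\<bar>x\<bar>"]
  proof eventually_elim
    case (elim R)
    have "2 * pi * \<i> * (g (of_real x) / exp (of_real x)) - V R + V (-R) = 2 * pi * \<i> * of_real (I R)"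
      unfolding main[OF elim, symmetric] by simp
    then show ?case by simp
  qed
  ultimately have "((\<lambda>R. complex_of_real (I R)) \<longlongrightarrow> g (of_real x) / exp (of_real x)) at_top"
    by (simp add: tendsto_cong)
  also have "g (of_real x) = log_deriv_kernel \<alpha> (of_real x)"
    using gr assms(3) pi_gt_zero by (intro gr(4)) auto
  also have "log_deriv_kernel \<alpha> (of_real x) / exp (of_real x) =
      of_real ((\<alpha> / (1 - exp (- \<alpha> * x)) - 1 / (1 - exp (- x))) / exp x)"
    by (simp add: log_deriv_kernel_def flip: exp_of_real)
  finally show ?thesis
    unfolding tendsto_of_real_iff I_def .
qed

text \<open>The factor \<open>\<epsilon>\<close> makes the integrand nonnegative, so monotone
  convergence turns the limit over symmetric intervals into a Lebesgue integral.\<close>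

lemma stieltjes_has_bochner_integral:
  assumes \<alpha>: "0 < \<alpha>" "\<alpha> < 2" and sgn: "\<And>t. \<epsilon> * stieltjes_weight \<alpha> t \<ge> 0" and "z > 0" "z \<noteq> 1"
  shows "has_bochner_integral lborel (\<lambda>t. \<epsilon> * stieltjes_weight \<alpha> t / (exp t + z))
    (\<epsilon> * (\<alpha> * z powr (\<alpha> - 1) / (z powr \<alpha> - 1) - 1 / (z - 1)))"
proof -
  define x where "x = ln z"
  have x: "exp x = z" "x \<noteq> 0" using assms by (auto simp: x_def)
  define f where "f t = \<epsilon> * stieltjes_weight \<alpha> t / (exp t + z)" for t
  have pos: "exp t + z > 0" for t using assms(4) by (simp add: add_pos_pos)
  have cont: "continuous_on X f" for X
    unfolding f_def using pos by (intro continuous_intros continuous_on_stieltjes_weight \<alpha>) (metis less_irrefl)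
  have fm: "f \<in> borel_measurable borel"
    using cont by (rule borel_measurable_continuous_onI)
  have f0: "f t \<ge> 0" for t
    unfolding f_def using sgn[of t] pos[of t] by simp
  define L where "L = \<epsilon> * ((\<alpha> / (1 - exp (- \<alpha> * x)) - 1 / (1 - exp (- x))) / exp x)"
  have int: "integrable lborel (\<lambda>t. indicator {-real n..real n} t * f t)" for n
    using borel_integrable_compact[of "{-real n..real n}" f] cont by simp
  have "(\<lambda>n. \<epsilon> * integral {-real n..real n} (\<lambda>t. stieltjes_weight \<alpha> t / (exp t + exp x))) \<longlonglongrightarrow> L"
    unfolding L_def using filterlim_compose[OF stieltjes_integral_tendsto[OF \<alpha> x(2)] filterlim_real_sequentially]
    by (intro tendsto_mult_left)
  moreover have "\<epsilon> * integral {-real n..real n} (\<lambda>t. stieltjes_weight \<alpha> t / (exp t + exp x)) =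
      (\<integral>t. indicator {-real n..real n} t * f t \<partial>lborel)" for n
  proof -
    have "(\<integral>t. indicator {-real n..real n} t * f t \<partial>lborel) = integral {-real n..real n} f"
      using set_borel_integral_eq_integral(2)[of "{-real n..real n}" f] int[of n]
      by (simp add: set_integrable_def set_lebesgue_integral_def)
    also have "\<dots> = integral {-real n..real n} (\<lambda>t. \<epsilon> * (stieltjes_weight \<alpha> t / (exp t + exp x)))"
      by (simp add: f_def[abs_def] x)
    finally show ?thesis by (simp only: Henstock_Kurzweil_Integration.integral_mult_right)
  qed
  ultimately have lim: "(\<lambda>n. \<integral>t. indicator {-real n..real n} t * f t \<partial>lborel) \<longlonglongrightarrow> L"
    by simp
  have "mono (\<lambda>n. indicator {-real n..real n} t * f t)" for t
    using f0 by (intro monoI) (auto simp: indicator_def)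
  moreover have "(\<lambda>n. indicator {-real n..real n} t * f t) \<longlonglongrightarrow> f t" for t
  proof (rule tendsto_eventually)
    obtain N where N: "\<bar>t\<bar> \<le> real N" using real_arch_simple by blast
    show "\<forall>\<^sub>F n in sequentially. indicator {-real n..real n} t * f t = f t"
      using eventually_ge_at_top[of N]
      by eventually_elim (use N in \<open>auto simp: indicator_def\<close>)
  qed
  ultimately have "integrable lborel f" "integral\<^sup>L lborel f = L"
    using integral_monotone_convergence_nonneg[OF int _ _ _ lim, of f] fm f0 by auto
  then have "has_bochner_integral lborel f L"
    by (simp add: has_bochner_integral_iff)
  moreover have "L = \<epsilon> * (\<alpha> * z powr (\<alpha> - 1) / (z powr \<alpha> - 1) - 1 / (z - 1))"
  proof -
    have e: "exp (- \<alpha> * x) = 1 / z powr \<alpha>" "exp (- x) = 1 / z"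
      using assms(4) by (simp_all add: x_def powr_def exp_minus inverse_eq_divide)
    have e': "z powr (\<alpha> - 1) = z powr \<alpha> / z"
      using assms(4) by (simp add: powr_diff)
    have "z powr \<alpha> \<noteq> 1" "z powr \<alpha> > 0"
      using assms by (auto simp: powr_def)
    then have "\<alpha> / (1 - exp (- \<alpha> * x)) / z = \<alpha> * z powr (\<alpha> - 1) / (z powr \<alpha> - 1)"
      "1 / (1 - exp (- x)) / z = 1 / (z - 1)"
      using assms(4,5) unfolding e e' by (simp_all add: divide_simps)
    then show ?thesis
      unfolding L_def x(1) diff_divide_distrib by simp
  qed
  ultimately show ?thesis by (simp add: f_def[abs_def])
qed

section \<open>Hyperbolic complete monotonicity of the density\<close>

text \<open>For w >= 2, the root v >= 1 of v + 1 / v = w; the other root is 1 / v.\<close>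

definition joukowski_inv :: "real \<Rightarrow> real" where
  "joukowski_inv w = (w + sqrt (w\<^sup>2 - 4)) / 2"

lemma joukowski_inv_of_ge_1:
  assumes "v \<ge> 1"
  shows "joukowski_inv (v + 1 / v) = v"
proof -
  have "(v + 1 / v)\<^sup>2 - 4 = (v - 1 / v)\<^sup>2"
    using assms by (simp add: power2_eq_square field_simps)
  moreover have "v - 1 / v \<ge> 0"
    using assms by (simp add: field_simps) (metis mult_mono' one_le_numeral order.trans mult_1 zero_le_one)
  ultimately show ?thesis
    by (simp add: joukowski_inv_def)
qed

lemma joukowski_inv:
  assumes "w > 2"
  shows "joukowski_inv w > 1" "joukowski_inv w + 1 / joukowski_inv w = w"
proof -
  define r where "r = sqrt (w\<^sup>2 - 4)"
  have "w\<^sup>2 > 2\<^sup>2" using assms by (intro power_strict_mono) auto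
  then have r: "r > 0" "r\<^sup>2 = w\<^sup>2 - 4" by (auto simp: r_def)
  then show "joukowski_inv w > 1"
    using assms by (simp add: joukowski_inv_def flip: r_def)
  have "(w + r) * (w - r) = 4" using r(2) by (simp add: power2_eq_square algebra_simps)
  moreover have "w + r > 0" using r assms by linarith
  ultimately have "1 / ((w + r) / 2) = (w - r) / 2" by (simp add: field_simps)
  then show "joukowski_inv w + 1 / joukowski_inv w = w"
    by (simp add: joukowski_inv_def r_def field_simps)
qed

lemma has_real_derivative_joukowski_inv:
  assumes "w > 2"
  shows "(joukowski_inv has_real_derivative (joukowski_inv w)\<^sup>2 / ((joukowski_inv w)\<^sup>2 - 1)) (at w)"
proof -
  define r where "r = sqrt (w\<^sup>2 - 4)"
  define v where "v = joukowski_inv w"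
  have "w\<^sup>2 > 2\<^sup>2" using assms by (intro power_strict_mono) auto
  then have r: "r > 0" "w\<^sup>2 - 4 > 0" by (auto simp: r_def)
  have v: "v > 1" "v + 1 / v = w" using joukowski_inv[OF assms] by (auto simp: v_def)
  have rv: "r = v - 1 / v"
  proof -
    have "r = 2 * v - w" by (simp add: v_def joukowski_inv_def r_def field_simps)
    then show ?thesis using v(2) by simp
  qed
  have "v\<^sup>2 > 1" using v(1) by (simp add: one_less_power)
  have "(joukowski_inv has_real_derivative (1 + w / r) / 2) (at w)"
    unfolding joukowski_inv_def[abs_def] r_def using r
    by (auto intro!: derivative_eq_intros simp: field_simps)
  also have "(1 + w / r) / 2 = (r + w) / (2 * r)"
    using r by (simp add: field_simps)
  also have "\<dots> = v / r" by (simp add: v_def joukowski_inv_def r_def)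
  also have "\<dots> = v\<^sup>2 / (v\<^sup>2 - 1)"
    unfolding rv using v(1) \<open>v\<^sup>2 > 1\<close> by (simp add: field_simps power2_eq_square)
  finally show ?thesis by (simp add: v_def)
qed

text \<open>The expression is symmetric under exchange of v and 1 / v, so the branch v >= 1 can be
  substituted and the existential over functions of w disappears. Positivity is left out and handled
  separately.\<close>

definition hcm :: "(real \<Rightarrow> real) \<Rightarrow> bool" where
  "hcm f \<longleftrightarrow> (\<forall>u>0. cmono 2 (\<lambda>w. f (u * joukowski_inv w) * f (u / joukowski_inv w)))"

lemma hcm_imp_hyperbolically_completely_monotone:
  assumes "hcm f" "\<And>x. x > 0 \<Longrightarrow> f x > 0"
  shows "hyperbolically_completely_monotone f"
  unfolding hyperbolically_completely_monotone_def
proof (intro conjI allI impI)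
  fix u :: real assume u: "u > 0"
  define h where "h w = f (u * joukowski_inv w) * f (u / joukowski_inv w)" for w
  have "completely_monotone_on {2..} h"
    using assms(1) u unfolding hcm_def h_def by (blast intro: cmono_imp_completely_monotone_on)
  moreover have "f (u * v) * f (u / v) = h (v + 1 / v)" if "v > 0" for v
  proof (cases "v \<ge> 1")
    case True
    then show ?thesis by (simp add: h_def joukowski_inv_of_ge_1)
  next
    case False
    then have "joukowski_inv (1 / v + 1 / (1 / v)) = 1 / v"
      using that by (intro joukowski_inv_of_ge_1) auto
    then have "joukowski_inv (v + 1 / v) = 1 / v"
      by (simp add: add.commute)
    then show ?thesis by (simp add: h_def mult.commute)
  qed
  ultimately show "\<exists>h. completely_monotone_on {2..} h \<and>
      (\<forall>v>0. f (u * v) * f (u / v) = h (v + 1 / v))" by blast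
qed (use assms in auto)

lemma hcm_mult:
  assumes "hcm f" "hcm g"
  shows "hcm (\<lambda>x. f x * g x)"
  unfolding hcm_def
proof (intro allI impI)
  fix u :: real assume "u > 0"
  then have "cmono 2 (\<lambda>w. (f (u * joukowski_inv w) * f (u / joukowski_inv w)) *
     (g (u * joukowski_inv w) * g (u / joukowski_inv w)))"
    using assms by (auto simp: hcm_def intro: cmono_mult)
  then show "cmono 2 (\<lambda>w. f (u * joukowski_inv w) * g (u * joukowski_inv w) *
      (f (u / joukowski_inv w) * g (u / joukowski_inv w)))"
    by (simp add: mult.left_commute mult.commute mult.assoc)
qed

lemma hcm_const: "c \<ge> 0 \<Longrightarrow> hcm (\<lambda>x. c)"
  by (simp add: hcm_def cmono_const)

lemma hcm_cong:
  assumes "hcm f" "\<And>x. x > 0 \<Longrightarrow> f x = g x"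
  shows "hcm g"
  unfolding hcm_def
proof (intro allI impI)
  fix u :: real assume u: "u > 0"
  show "cmono 2 (\<lambda>w. g (u * joukowski_inv w) * g (u / joukowski_inv w))"
  proof (rule cmono_cong)
    show "cmono 2 (\<lambda>w. f (u * joukowski_inv w) * f (u / joukowski_inv w))"
      using assms(1) u by (simp add: hcm_def)
    fix w :: real assume "w > 2"
    then show "f (u * joukowski_inv w) * f (u / joukowski_inv w) =
        g (u * joukowski_inv w) * g (u / joukowski_inv w)"
      using u joukowski_inv(1)[of w] by (simp add: assms(2))
  qed
qed

text \<open>The values at u v and u / v multiply to a power of \<open>u * u\<close>, constant in w,
  so the exponent may have either sign.\<close>

lemma hcm_powr: "hcm (\<lambda>x. x powr a)"
  unfolding hcm_def
proof (intro allI impI)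
  fix u :: real assume u: "u > 0"
  show "cmono 2 (\<lambda>w. (u * joukowski_inv w) powr a * (u / joukowski_inv w) powr a)"
  proof (rule cmono_cong)
    show "cmono 2 (\<lambda>w. (u * u) powr a)" by (rule cmono_const) simp
    fix w :: real assume "w > 2"
    then show "(u * u) powr a = (u * joukowski_inv w) powr a * (u / joukowski_inv w) powr a"
      using u joukowski_inv(1)[of w] by (simp flip: powr_mult)
  qed
qed

text \<open>The product (t + u v) (t + u / v) is affine in w with positive slope t u.\<close>

lemma hcm_affine_powr:
  assumes "t > 0" "q \<ge> 0"
  shows "hcm (\<lambda>x. (t + x) powr - q)"
  unfolding hcm_def
proof (intro allI impI)
  fix u :: real assume u: "u > 0"
  show "cmono 2 (\<lambda>w. (t + u * joukowski_inv w) powr - q * (t + u / joukowski_inv w) powr - q)"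
  proof (rule cmono_cong)
    show "cmono 2 (\<lambda>w. (t\<^sup>2 + u\<^sup>2 + t * u * w) powr - q)"
      using assms u by (intro cmono_affine_powr) (auto intro!: add_pos_pos)
    fix w :: real assume w: "w > 2"
    define v where "v = joukowski_inv w"
    have v: "v > 1" "w = v + 1 / v" using joukowski_inv[OF w] by (auto simp: v_def)
    have "t\<^sup>2 + u\<^sup>2 + t * u * w = (t + u * v) * (t + u / v)"
      unfolding v(2) using v(1) by (simp add: field_simps power2_eq_square)
    then show "(t\<^sup>2 + u\<^sup>2 + t * u * w) powr - q =
        (t + u * joukowski_inv w) powr - q * (t + u / joukowski_inv w) powr - q"
      using v(1) u assms(1) unfolding v_def[symmetric] by (simp add: powr_mult)
  qed
qed

section \<open>Powers of \<open>((1 + x) powr \<alpha> - 1) / x\<close>\<close>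

lemma powr_one_plus_minus_one_pos:
  fixes x \<alpha> :: real
  assumes "x > 0" "\<alpha> > 0"
  shows "(1 + x) powr \<alpha> - 1 > 0"
  using assms by simp

lemma has_real_derivative_ln_powr_quotient:
  assumes "x > 0" "\<alpha> > 0"
  shows "((\<lambda>x. ln (((1 + x) powr \<alpha> - 1) / x)) has_real_derivative
    \<alpha> * (1 + x) powr (\<alpha> - 1) / ((1 + x) powr \<alpha> - 1) - 1 / x) (at x)"
proof -
  have pos: "(1 + x) powr \<alpha> - 1 > 0"
    by (rule powr_one_plus_minus_one_pos[OF assms])
  have "((\<lambda>x. (1 + x) powr \<alpha> - 1) has_real_derivative \<alpha> * (1 + x) powr (\<alpha> - 1)) (at x)"
    using assms(1) by (auto intro!: derivative_eq_intros)
  from DERIV_diff[OF DERIV_chain2[OF DERIV_ln_divide[OF pos] this] DERIV_ln_divide[OF assms(1)]]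
  have D: "((\<lambda>x. ln ((1 + x) powr \<alpha> - 1) - ln x) has_real_derivative
      \<alpha> * (1 + x) powr (\<alpha> - 1) / ((1 + x) powr \<alpha> - 1) - 1 / x) (at x)"
    by simp
  have eq: "ln ((1 + x) powr \<alpha> - 1) - ln x = ln (((1 + x) powr \<alpha> - 1) / x)" if "x > 0" for x
    using powr_one_plus_minus_one_pos[OF that assms(2)] that assms(2) by (simp add: ln_div)
  show ?thesis
    by (rule iffD1[OF has_real_derivative_cong_Ioi[OF eq assms(1)] D])
qed

text \<open>Minus the logarithm of the product at u v and u / v is \<open>B\<close>, and its
  derivative in w is a nonnegative multiple of a Stieltjes transform of \<open>\<epsilon>\<close>
  times the weight. The exponential of \<open>- B\<close> is therefore completely monotone. The
  choice of \<open>\<epsilon>\<close> as 1 or -1 selects negative or positive powers.\<close>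

lemma hcm_powr_quotient:
  assumes \<alpha>: "0 < \<alpha>" "\<alpha> < 2" and sgn: "\<And>t. \<epsilon> * stieltjes_weight \<alpha> t \<ge> 0" and "\<gamma> \<ge> 0"
  shows "hcm (\<lambda>x. (((1 + x) powr \<alpha> - 1) / x) powr (- \<epsilon> * \<gamma>))"
  unfolding hcm_def
proof (intro allI impI)
  fix u :: real assume u: "u > 0"
  define K where "K x = ((1 + x) powr \<alpha> - 1) / x" for x
  define \<psi> where "\<psi> x = \<alpha> * (1 + x) powr (\<alpha> - 1) / ((1 + x) powr \<alpha> - 1) - 1 / x" for x
  have K: "K x > 0" if "x > 0" for x
    using powr_one_plus_minus_one_pos[OF that \<alpha>(1)] that by (simp add: K_def)
  define m where "m t = \<epsilon> * stieltjes_weight \<alpha> t" for t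
  \<comment> \<open>From (T + u v) (T + u / v) = T u (T / u + u / T + w) with T = 1 + exp t.\<close>
  define c where "c t = (1 + exp t) / u + u / (1 + exp t)" for t
  define B where "B w = \<gamma> * (\<epsilon> * (ln (K (u * joukowski_inv w)) + ln (K (u / joukowski_inv w))))" for w
  have bochner: "has_bochner_integral lborel (\<lambda>t. m t / (1 + exp t + x)) (\<epsilon> * \<psi> x)" if "x > 0" for x
    using stieltjes_has_bochner_integral[OF \<alpha> sgn, of "1 + x"] that
    by (simp add: m_def \<psi>_def add.commute add.left_commute)
  have c0: "c t > 0" for t
    using u by (auto simp: c_def intro!: add_pos_pos divide_pos_pos)
  have step: "(B has_real_derivative \<gamma> * (\<integral>t. m t / (c t + w) \<partial>lborel)) (at w) \<and>
      integrable lborel (\<lambda>t. m t / (c t + w))" if w: "w > 2" for w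
  proof -
    define v where "v = joukowski_inv w"
    have v: "v > 1" "w = v + 1 / v" using joukowski_inv[OF w] by (auto simp: v_def)
    have v2: "v\<^sup>2 > 1" using v(1) by (simp add: one_less_power)
    define d where "d = v\<^sup>2 / (v\<^sup>2 - 1)"
    \<comment> \<open>The coefficients are the derivatives of u v and u / v with respect to w, where
      \<open>d\<close> is that of v. With them the two fractions combine to the single kernel
      \<open>1 / (c t + w)\<close>.\<close>
    have "has_bochner_integral lborel (\<lambda>t. u * d * (m t / (1 + exp t + u * v)) - u * d / v\<^sup>2 * (m t / (1 + exp t + u / v)))
        (u * d * (\<epsilon> * \<psi> (u * v)) - u * d / v\<^sup>2 * (\<epsilon> * \<psi> (u / v)))"
      using u v(1) by (intro has_bochner_integral_diff has_bochner_integral_mult_right bochner) auto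
    moreover have "u * d * (m t / (1 + exp t + u * v)) - u * d / v\<^sup>2 * (m t / (1 + exp t + u / v)) =
        m t / (c t + w)" for t
    proof -
      define T where "T = 1 + exp t"
      have T: "T > 0" by (simp add: T_def add_pos_pos)
      have pos: "T + u * v > 0" "T + u / v > 0" "v > 0"
        using T u v(1) by (auto intro!: add_pos_pos)
      have "u * d / (T + u * v) - u * d / v\<^sup>2 / (T + u / v) = u / (v\<^sup>2 - 1) * (v\<^sup>2 / (T + u * v) - 1 / (T + u / v))"
        using v(1) by (simp add: d_def right_diff_distrib)
      also have "v\<^sup>2 / (T + u * v) - 1 / (T + u / v) = (v\<^sup>2 * (T + u / v) - (T + u * v)) / ((T + u * v) * (T + u / v))"
        using pos(1,2) by (subst diff_frac_eq) auto
      also have "v\<^sup>2 * (T + u / v) - (T + u * v) = T * (v\<^sup>2 - 1)"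
        using pos(3) by (simp add: field_simps power2_eq_square)
      also have "(T + u * v) * (T + u / v) = T * u * (T / u + u / T + w)"
        using pos(3) u T unfolding v(2) by (simp add: field_simps)
      also have "u / (v\<^sup>2 - 1) * (T * (v\<^sup>2 - 1) / (T * u * (T / u + u / T + w))) = 1 / (T / u + u / T + w)"
        using v2 u T by simp
      finally have *: "u * d / (T + u * v) - u * d / v\<^sup>2 / (T + u / v) = 1 / (c t + w)"
        by (simp add: c_def T_def)
      have "u * d * (m t / (T + u * v)) - u * d / v\<^sup>2 * (m t / (T + u / v)) =
          m t * (u * d / (T + u * v) - u * d / v\<^sup>2 / (T + u / v))"
        by (simp add: right_diff_distrib mult.commute)
      then show ?thesis unfolding * by (simp add: T_def)
    qed
    ultimately have hb: "has_bochner_integral lborel (\<lambda>t. m t / (c t + w))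
        (u * d * (\<epsilon> * \<psi> (u * v)) - u * d / v\<^sup>2 * (\<epsilon> * \<psi> (u / v)))"
      by simp
    have dv: "(joukowski_inv has_real_derivative d) (at w)"
      using has_real_derivative_joukowski_inv[OF w] by (simp add: d_def v_def)
    have dK: "((\<lambda>x. ln (K x)) has_real_derivative \<psi> x) (at x)" if "x > 0" for x
      unfolding K_def \<psi>_def using has_real_derivative_ln_powr_quotient[OF that \<alpha>(1)] .
    have "((\<lambda>w. ln (K (u * joukowski_inv w))) has_real_derivative \<psi> (u * v) * (u * d)) (at w)"
      using u v(1) unfolding v_def by (intro DERIV_chain2[OF dK] DERIV_cmult dv) auto
    moreover have "((\<lambda>w. u / joukowski_inv w) has_real_derivative - (u * d / v\<^sup>2)) (at w)"
      using dv v(1) by (auto intro!: derivative_eq_intros simp: v_def power2_eq_square)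
    then have "((\<lambda>w. ln (K (u / joukowski_inv w))) has_real_derivative \<psi> (u / v) * - (u * d / v\<^sup>2)) (at w)"
      using u v(1) unfolding v_def by (intro DERIV_chain2[OF dK]) auto
    ultimately have "(B has_real_derivative \<gamma> * (\<epsilon> * (\<psi> (u * v) * (u * d) + \<psi> (u / v) * - (u * d / v\<^sup>2)))) (at w)"
      unfolding B_def by (intro DERIV_cmult DERIV_add)
    also have "\<epsilon> * (\<psi> (u * v) * (u * d) + \<psi> (u / v) * - (u * d / v\<^sup>2)) = (\<integral>t. m t / (c t + w) \<partial>lborel)"
      using has_bochner_integral_integral_eq[OF hb] by (simp add: algebra_simps)
    finally show ?thesis
      using hb by (auto simp: has_bochner_integral_iff)
  qed
  have m: "m \<in> borel_measurable borel"
    unfolding m_def using continuous_on_stieltjes_weight[OF \<alpha>]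
    by (intro borel_measurable_continuous_onI continuous_intros)
  have "c \<in> borel_measurable borel"
    unfolding c_def by measurable
  then have "cmono 2 (\<lambda>w. \<integral>t. m t / (c t + w) \<partial>lborel)"
  proof (intro cmono_Stieltjes)
    show "c t \<ge> - 2" for t using c0[of t] by simp
    show "m t \<ge> 0" for t using sgn[of t] by (simp add: m_def)
  qed (use step m in auto)
  then have "cmono 2 (\<lambda>w. exp (- B w))"
    using step assms(4) by (intro cmono_exp_minus[where B' = "\<lambda>w. \<gamma> * (\<integral>t. m t / (c t + w) \<partial>lborel)"] cmono_cmult) auto
  then have "cmono 2 (\<lambda>w. K (u * joukowski_inv w) powr (- \<epsilon> * \<gamma>) * K (u / joukowski_inv w) powr (- \<epsilon> * \<gamma>))"
  proof (rule cmono_cong)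
    fix w :: real assume w: "w > 2"
    have "K (u * joukowski_inv w) > 0" "K (u / joukowski_inv w) > 0"
      using u joukowski_inv(1)[OF w] by (auto intro!: K)
    then show "exp (- B w) = K (u * joukowski_inv w) powr (- \<epsilon> * \<gamma>) * K (u / joukowski_inv w) powr (- \<epsilon> * \<gamma>)"
      by (simp add: B_def powr_def algebra_simps flip: exp_add)
  qed
  then show "cmono 2 (\<lambda>w. (((1 + u * joukowski_inv w) powr \<alpha> - 1) / (u * joukowski_inv w)) powr (- \<epsilon> * \<gamma>) *
      (((1 + u / joukowski_inv w) powr \<alpha> - 1) / (u / joukowski_inv w)) powr (- \<epsilon> * \<gamma>))"
    by (simp only: K_def)
qed

lemma stieltjes_weight_sign:
  assumes "0 < \<alpha>" "\<alpha> < 2"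
  shows "\<alpha> \<le> 1 \<Longrightarrow> stieltjes_weight \<alpha> t \<le> 0" "\<alpha> \<ge> 1 \<Longrightarrow> stieltjes_weight \<alpha> t \<ge> 0"
proof -
  have pos: "2 * pi * (cosh (\<alpha> * t) - cos (pi * \<alpha>)) > 0"
    using stieltjes_weight_denominator_pos[OF assms, of t] by simp
  show "stieltjes_weight \<alpha> t \<le> 0" if "\<alpha> \<le> 1"
  proof -
    have "sin (pi * \<alpha>) \<ge> 0" using assms that by (intro sin_ge_zero) auto
    then show ?thesis
      using pos assms unfolding stieltjes_weight_def by (intro divide_nonpos_pos) auto
  qed
  show "stieltjes_weight \<alpha> t \<ge> 0" if "\<alpha> \<ge> 1"
  proof -
    have "sin (pi * \<alpha>) \<le> 0" using assms that by (intro sin_le_zero) auto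
    then show ?thesis
      using pos assms unfolding stieltjes_weight_def
      by (intro divide_nonneg_pos) (auto simp: mult_nonneg_nonpos)
  qed
qed

definition beta_type_density :: "real \<Rightarrow> real \<Rightarrow> real \<Rightarrow> real \<Rightarrow> real" where
  "beta_type_density \<alpha> p e x = (1 + x) powr - p * ((1 + x) powr \<alpha> - 1) powr e"

lemma beta_type_density_pos: "x > 0 \<Longrightarrow> \<alpha> > 0 \<Longrightarrow> beta_type_density \<alpha> p e x > 0"
  using powr_one_plus_minus_one_pos[of x \<alpha>] by (simp add: beta_type_density_def)

lemma hcm_beta_type_density_kernel:
  assumes \<alpha>: "0 < \<alpha>" and p: "p \<ge> 0" and "hcm (\<lambda>x. (((1 + x) powr \<alpha> - 1) / x) powr e)"
  shows "hcm (beta_type_density \<alpha> p e)"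
proof (rule hcm_cong)
  show "hcm (\<lambda>x. (1 + x) powr - p * (x powr e * (((1 + x) powr \<alpha> - 1) / x) powr e))"
    using assms by (intro hcm_mult hcm_affine_powr hcm_powr) auto
  fix x :: real assume x: "x > 0"
  then show "(1 + x) powr - p * (x powr e * (((1 + x) powr \<alpha> - 1) / x) powr e) = beta_type_density \<alpha> p e x"
    using powr_one_plus_minus_one_pos[OF x \<alpha>] by (simp add: beta_type_density_def flip: powr_mult)
qed

lemma hcm_beta_type_density:
  assumes "p \<ge> 0" "0 < \<alpha>"
    and "e = 0 \<or> \<alpha> = 1 \<or> (e > 0 \<and> \<alpha> < 1) \<or> (e < 0 \<and> 1 < \<alpha> \<and> \<alpha> \<le> 2)"
  shows "hcm (beta_type_density \<alpha> p e)"
  using assms(3)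
proof (elim disjE conjE)
  assume "e = 0"
  moreover have "hcm (\<lambda>x. (1::real))" by (rule hcm_const) simp
  then have "hcm (\<lambda>x. (((1 + x) powr \<alpha> - 1) / x) powr 0)"
    by (rule hcm_cong) (use powr_one_plus_minus_one_pos assms in fastforce)
  ultimately show ?thesis using assms by (simp add: hcm_beta_type_density_kernel)
next
  assume \<alpha>: "\<alpha> = 1"
  have "hcm (\<lambda>x. (1::real))" by (rule hcm_const) simp
  then have "hcm (\<lambda>x. (((1 + x) powr \<alpha> - 1) / x) powr e)"
    by (rule hcm_cong) (simp add: \<alpha>)
  then show ?thesis using assms by (simp add: hcm_beta_type_density_kernel)
next
  assume e: "e > 0" "\<alpha> < 1"
  \<comment> \<open>For \<alpha> < 1 the weight is nonpositive, so \<open>\<epsilon>\<close> is -1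
    and positive powers are the admissible ones.\<close>
  have "hcm (\<lambda>x. (((1 + x) powr \<alpha> - 1) / x) powr (- (-1) * e))"
    using e assms stieltjes_weight_sign(1)[of \<alpha>] by (intro hcm_powr_quotient) auto
  then show ?thesis using assms by (simp add: hcm_beta_type_density_kernel)
next
  assume e: "e < 0" "1 < \<alpha>" "\<alpha> \<le> 2"
  show ?thesis
  proof (cases "\<alpha> = 2")
    case False
    have "hcm (\<lambda>x. (((1 + x) powr \<alpha> - 1) / x) powr (- 1 * (- e)))"
      using e False assms stieltjes_weight_sign(2)[of \<alpha>] by (intro hcm_powr_quotient) auto
    then show ?thesis using assms by (simp add: hcm_beta_type_density_kernel)
  next
    case True
    have "hcm (\<lambda>x. (2 + x) powr - (- e))"
      using e by (intro hcm_affine_powr) auto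
    then have "hcm (\<lambda>x. (((1 + x) powr \<alpha> - 1) / x) powr e)"
    proof (rule hcm_cong)
      fix x :: real assume "x > 0"
      then have "((1 + x) powr \<alpha> - 1) / x = 2 + x"
        by (simp add: True powr_numeral field_simps power2_eq_square)
      then show "(2 + x) powr - (- e) = (((1 + x) powr \<alpha> - 1) / x) powr e" by simp
    qed
    then show ?thesis using assms by (simp add: hcm_beta_type_density_kernel)
  qed
qed

section \<open>Analytic continuation of complete monotonicity\<close>

text \<open>
  At the infimum \<open>m\<close> of the half-line where the signs alternate they still do so by continuity, and
  the Taylor expansion at \<open>m\<close> then propagates them to the left of \<open>m\<close>.
\<close>

lemma alternating_derivatives_continuation:
  fixes G :: "complex \<Rightarrow> complex"
  assumes U: "open U" and G: "G holomorphic_on U"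
    and sub: "\<And>x. x > L \<Longrightarrow> of_real x \<in> U"
    and M: "\<And>x n. x > M \<Longrightarrow> (-1) ^ n * Re ((deriv ^^ n) G (of_real x)) \<ge> 0"
    and "x > L"
  shows "(-1) ^ n * Re ((deriv ^^ n) G (of_real x)) \<ge> 0"
proof -
  define P where "P y \<longleftrightarrow> (\<forall>n. (-1) ^ n * Re ((deriv ^^ n) G (of_real y)) \<ge> 0)" for y
  have "P x"
  proof (rule ccontr)
    assume "\<not> P x"
    define A where "A = {y. y > L \<and> \<not> P y}"
    have xA: "x \<in> A" using \<open>\<not> P x\<close> assms(5) by (simp add: A_def)
    have bdd: "bdd_above A"
      using M unfolding A_def P_def by (intro bdd_aboveI[of _ M]) force
    define m where "m = Sup A"
    have m: "m > L" using cSup_upper[OF xA bdd] assms(5) by (simp add: m_def)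
    have Pm': "P y" if "y > m" for y
    proof (rule ccontr)
      assume "\<not> P y"
      then have "y \<in> A" using that m by (simp add: A_def)
      then have "y \<le> m" using cSup_upper bdd by (simp add: m_def)
      with that show False by simp
    qed
    have holo: "(deriv ^^ n) G holomorphic_on U" for n
      using G U by (intro holomorphic_intros)
    have Pm: "P m"
      unfolding P_def
    proof
      fix n
      have "isCont ((deriv ^^ n) G) (of_real m)"
        using holomorphic_on_imp_continuous_on[OF holo[of n]] U sub[OF m]
        by (simp add: continuous_on_eq_continuous_at)
      then have "isCont (\<lambda>y. (-1) ^ n * Re ((deriv ^^ n) G (of_real y))) m"
        by (intro continuous_intros isCont_o2[of m of_real]) auto
      then have "((\<lambda>y. (-1) ^ n * Re ((deriv ^^ n) G (of_real y))) \<longlongrightarrow>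
          (-1) ^ n * Re ((deriv ^^ n) G (of_real m))) (at_right m)"
        by (metis continuous_within filterlim_at_split)
      moreover have "\<forall>\<^sub>F y in at_right m. (-1) ^ n * Re ((deriv ^^ n) G (of_real y)) \<ge> 0"
        using Pm' by (auto simp: P_def eventually_at_filter)
      ultimately show "(-1) ^ n * Re ((deriv ^^ n) G (of_real m)) \<ge> 0"
        by (rule tendsto_lowerbound) simp
    qed
    \<comment> \<open>The radius may depend on \<open>m\<close>: any step to the left of the
      supremum of the bad points already gives a contradiction.\<close>
    obtain \<epsilon> where \<epsilon>: "\<epsilon> > 0" "ball (of_real m) \<epsilon> \<subseteq> U"
      using U sub[OF m] openE by blast
    have "P y" if y: "m - \<epsilon> < y" "y \<le> m" for y
      unfolding P_def
    proof
      fix n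
      let ?t = "\<lambda>k. (deriv ^^ k) ((deriv ^^ n) G) (of_real m) / fact k * (of_real y - of_real m) ^ k"
      have "of_real y \<in> ball (complex_of_real m) \<epsilon>"
        using y by (simp add: dist_real_def)
      then have "?t sums (deriv ^^ n) G (of_real y)"
        using holomorphic_on_subset[OF holo \<epsilon>(2)] by (intro holomorphic_power_series)
      then have sums: "(\<lambda>k. (-1) ^ n * Re (?t k)) sums ((-1) ^ n * Re ((deriv ^^ n) G (of_real y)))"
        by (intro sums_mult sums_Re)
      have "0 \<le> (-1) ^ n * Re (?t k)" for k
      proof -
        have "?t k = (deriv ^^ (k + n)) G (of_real m) * of_real ((y - m) ^ k / fact k)"
          by (simp add: funpow_add)
        then have "Re (?t k) = Re ((deriv ^^ (k + n)) G (of_real m)) * ((y - m) ^ k / fact k)"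
          by (metis Im_complex_of_real Re_complex_of_real diff_zero mult_zero_right times_complex.simps(1))
        \<comment> \<open>To the left of \<open>m\<close> the sign from the power cancels the sign
          of the k-th further derivative, so every Taylor term of the n-th derivative has sign
          \<open>(-1) ^ n\<close>.\<close>
        also have "(y - m) ^ k = (-1) ^ k * (m - y) ^ k"
          by (simp flip: power_mult_distrib)
        finally have "(-1) ^ n * Re (?t k) =
          ((-1) ^ (k + n) * Re ((deriv ^^ (k + n)) G (of_real m))) * ((m - y) ^ k / fact k)"
          by (simp add: power_add)
        also have "\<dots> \<ge> 0"
          using Pm y unfolding P_def by (intro mult_nonneg_nonneg[of "_ * Re _"]) auto
        finally show ?thesis .
      qed
      then show "(-1) ^ n * Re ((deriv ^^ n) G (of_real y)) \<ge> 0"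
        by (rule sums_le[OF _ sums_zero sums])
    qed
    then have "\<not> (m - \<epsilon> < y)" if "y \<in> A" for y
      using that Pm' unfolding A_def by fastforce
    then have "m \<le> m - \<epsilon>"
      unfolding m_def using xA by (intro cSup_least) (auto simp: not_less)
    with \<epsilon>(1) show False by simp
  qed
  then show ?thesis by (simp add: P_def)
qed

lemma higher_deriv_of_real:
  fixes G :: "complex \<Rightarrow> complex" and h :: "real \<Rightarrow> real"
  assumes U: "open U" and G: "G holomorphic_on U"
    and sub: "\<And>x. x > M \<Longrightarrow> of_real x \<in> U"
    and eq: "\<And>x. x > M \<Longrightarrow> G (of_real x) = of_real (h x)"
    and diff: "\<And>n x. x > M \<Longrightarrow> (deriv ^^ n) h differentiable at x"
    and "x > M"
  shows "(deriv ^^ n) G (of_real x) = of_real ((deriv ^^ n) h x)"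
  using assms(6)
proof (induction n arbitrary: x)
  case (Suc n)
  have "(deriv ^^ n) G holomorphic_on U"
    using G U by (intro holomorphic_intros)
  then have "((deriv ^^ n) G has_field_derivative (deriv ^^ Suc n) G (of_real x)) (at (of_real x))"
    using holomorphic_derivI[OF _ U sub[OF Suc.prems]] by simp
  then have 1: "((\<lambda>x. (deriv ^^ n) G (of_real x)) has_vector_derivative (deriv ^^ Suc n) G (of_real x)) (at x)"
    by (rule has_vector_derivative_real_field)
  have "((deriv ^^ n) h has_real_derivative (deriv ^^ Suc n) h x) (at x)"
    using diff[OF Suc.prems, of n] by (auto simp: real_differentiable_def DERIV_imp_deriv)
  then have "((\<lambda>x. complex_of_real ((deriv ^^ n) h x)) has_vector_derivative of_real ((deriv ^^ Suc n) h x)) (at x)"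
    by (rule has_vector_derivative_of_real)
  then have "((\<lambda>x. (deriv ^^ n) G (of_real x)) has_vector_derivative of_real ((deriv ^^ Suc n) h x)) (at x)"
    by (rule has_vector_derivative_transform_within_open[where S = "{M<..}"])
      (use Suc in auto)
  with 1 show ?case
    by (rule vector_derivative_unique_at)
qed (use eq in simp)

text \<open>Only the first derivative enters the conclusion, but carrying its sign from
  \<open>M\<close> down to \<open>L\<close> takes the signs of all derivatives.\<close>

lemma completely_monotone_on_antimono_continuation:
  assumes cm: "completely_monotone_on {M..} h"
    and U: "open U" and G: "G holomorphic_on U"
    and sub: "\<And>x. x > L \<Longrightarrow> of_real x \<in> U" and "L \<le> M"
    and eq: "\<And>x. x > M \<Longrightarrow> G (of_real x) = of_real (h x)"
    and ab: "L < x" "x \<le> y"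
  shows "Re (G (of_real y)) \<le> Re (G (of_real x))"
proof (rule DERIV_nonpos_imp_nonincreasing[OF ab(2)])
  fix z assume "x \<le> z" "z \<le> y"
  then have z: "z > L" using ab by simp
  have "(-1) ^ n * Re ((deriv ^^ n) G (of_real x)) \<ge> 0" if "x > M" for x n
  proof -
    have "(deriv ^^ n) G (of_real x) = of_real ((deriv ^^ n) h x)"
      using sub assms(5) cm eq that
      by (intro higher_deriv_of_real[OF U G, of M]) (auto simp: completely_monotone_on_def)
    then show ?thesis
      using cm that by (simp add: completely_monotone_on_def)
  qed
  from alternating_derivatives_continuation[OF U G sub this z, where n = 1]
  have "Re (deriv G (of_real z)) \<le> 0" by simp
  moreover have "((\<lambda>x. Re (G (of_real x))) has_real_derivative Re (deriv G (of_real z))) (at z)"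
  proof -
    have "(G has_field_derivative deriv G (of_real z)) (at (of_real z))"
      using holomorphic_derivI[OF G U sub[OF z]] .
    then have "((\<lambda>x. G (of_real x)) has_vector_derivative deriv G (of_real z)) (at z)"
      by (rule has_vector_derivative_real_field)
    then show ?thesis
      using bounded_linear.has_vector_derivative[OF bounded_linear_Re]
      by (simp add: has_real_derivative_iff_has_vector_derivative)
  qed
  ultimately show "\<exists>d. ((\<lambda>x. Re (G (of_real x))) has_real_derivative d) (at z) \<and> d \<le> 0"
    by blast
qed

section \<open>Functions of \<open>q + 1 / q\<close>\<close>

text \<open>The identity (A + B) (B - A) = 4 makes the squares of (A + B) / 2 and (B - A) / 2
  reciprocal. Leaving the choice of both square roots open allows two different branches
  below.\<close>

lemma joukowski_root:
  fixes A B w :: complex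
  assumes "A\<^sup>2 = w - 2" "B\<^sup>2 = w + 2"
  shows "((A + B) / 2)\<^sup>2 \<noteq> 0" "((A + B) / 2)\<^sup>2 + 1 / ((A + B) / 2)\<^sup>2 = w"
proof -
  have *: "(A + B) * (B - A) = 4"
    using assms by (simp add: algebra_simps power2_eq_square)
  then show 0: "((A + B) / 2)\<^sup>2 \<noteq> 0" by auto
  have "((A + B) / 2)\<^sup>2 * ((B - A) / 2)\<^sup>2 = 1"
    using * by (simp add: power_divide flip: power_mult_distrib)
  then have "1 / ((A + B) / 2)\<^sup>2 = ((B - A) / 2)\<^sup>2"
    using 0 by (simp add: field_simps)
  then have "((A + B) / 2)\<^sup>2 + 1 / ((A + B) / 2)\<^sup>2 = ((A + B) / 2)\<^sup>2 + ((B - A) / 2)\<^sup>2"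
    by (simp only:)
  also have "\<dots> = ((A + B)\<^sup>2 + (B - A)\<^sup>2) / 4"
    unfolding power_divide by (simp add: add_divide_distrib)
  also have "\<dots> = (A\<^sup>2 + B\<^sup>2) / 2"
    by (simp add: power2_eq_square algebra_simps)
  finally show "((A + B) / 2)\<^sup>2 + 1 / ((A + B) / 2)\<^sup>2 = w"
    using assms by simp
qed

lemma joukowski_eq_iff:
  fixes q r :: complex
  assumes "q \<noteq> 0" "r \<noteq> 0" "q + 1 / q = r + 1 / r"
  shows "r = q \<or> r = 1 / q"
proof -
  have "(q - r) * (q * r - 1) = q * r * ((q + 1 / q) - (r + 1 / r))"
    using assms(1,2) by (simp add: field_simps)
  then have "(q - r) * (q * r - 1) = 0"
    using assms(3) by simp
  then have "q = r \<or> q * r = 1" by simp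
  then show ?thesis
    using assms by (auto simp: eq_divide_eq mult.commute)
qed

text \<open>Used in contrapositive form: both roots q of q + 1 / q = w avoid the cut when
  \<open>w + 2\<close> does.\<close>

lemma joukowski_nonpos:
  fixes q :: complex
  assumes "q \<in> \<real>\<^sub>\<le>\<^sub>0" "q \<noteq> 0"
  shows "q + 1 / q + 2 \<in> \<real>\<^sub>\<le>\<^sub>0"
proof -
  obtain r where r: "q = of_real r" "r \<le> 0" using assms(1) by (auto elim: nonpos_Reals_cases)
  with assms have "r < 0" by auto
  then have "r + 1 / r + 2 = (r + 1)\<^sup>2 / r"
    by (simp add: field_simps power2_eq_square)
  also have "\<dots> \<le> 0" using \<open>r < 0\<close> by (simp add: divide_nonneg_neg)
  finally have "complex_of_real (r + 1 / r + 2) \<in> \<real>\<^sub>\<le>\<^sub>0"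
    by (simp only: nonpos_Reals_of_real_iff)
  moreover have "complex_of_real (r + 1 / r + 2) = q + 1 / q + 2" by (simp add: r)
  ultimately show ?thesis by metis
qed

lemma one_div_in_nonpos_Reals_iff: "1 / q \<in> \<real>\<^sub>\<le>\<^sub>0 \<longleftrightarrow> (q::complex) \<in> \<real>\<^sub>\<le>\<^sub>0"
proof -
  have "1 / q \<in> \<real>\<^sub>\<le>\<^sub>0" if "q \<in> \<real>\<^sub>\<le>\<^sub>0" for q :: complex
    using that by (elim nonpos_Reals_cases) (metis divide_nonneg_nonpos nonpos_Reals_of_real_iff of_real_1 of_real_divide zero_le_one)
  from this[of q] this[of "1 / q"] show ?thesis by auto
qed

text \<open>The fibres of q + 1 / q are the pairs {q, 1 / q}, on which \<Phi> is constant, so any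
  inverse branch gives the same \<open>G\<close>. The branch \<open>r1\<close> is holomorphic away
  from w <= 2 and \<open>r2\<close> away from w >= 2. Together they cover everything except the
  critical value 2, where continuity removes the singularity.\<close>

lemma holomorphic_joukowski_descent:
  assumes \<Phi>: "\<Phi> holomorphic_on - \<real>\<^sub>\<le>\<^sub>0" and sym: "\<And>q. q \<notin> \<real>\<^sub>\<le>\<^sub>0 \<Longrightarrow> \<Phi> (1 / q) = \<Phi> q"
  obtains G where "G holomorphic_on {w. w + 2 \<notin> \<real>\<^sub>\<le>\<^sub>0}"
    "\<And>q. q \<notin> \<real>\<^sub>\<le>\<^sub>0 \<Longrightarrow> G (q + 1 / q) = \<Phi> q"
proof -
  define r1 where "r1 w = ((csqrt (w - 2) + csqrt (w + 2)) / 2)\<^sup>2" for w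
  define r2 where "r2 w = ((\<i> * csqrt (2 - w) + csqrt (w + 2)) / 2)\<^sup>2" for w
  define G where "G w = \<Phi> (r1 w)" for w
  have r1: "r1 w \<noteq> 0" "r1 w + 1 / r1 w = w" for w
    unfolding r1_def by (rule joukowski_root; simp)+
  have r2: "r2 w \<noteq> 0" "r2 w + 1 / r2 w = w" for w
    unfolding r2_def by (rule joukowski_root; simp add: power_mult_distrib)+
  have unique: "\<Phi> r = \<Phi> q" if "q \<notin> \<real>\<^sub>\<le>\<^sub>0" "r \<noteq> 0" "q + 1 / q = r + 1 / r" for q r
  proof -
    have "q \<noteq> 0" using that(1) by auto
    then show ?thesis
      using joukowski_eq_iff[OF _ that(2,3)] sym[OF that(1)] by auto
  qed
  define D where "D = {w::complex. w + 2 \<notin> \<real>\<^sub>\<le>\<^sub>0}"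
  have closed: "closed {w. f w \<in> \<real>\<^sub>\<le>\<^sub>0}" if "continuous_on UNIV f" for f :: "complex \<Rightarrow> complex"
    using closed_vimage[OF closed_nonpos_Reals_complex that] by (simp add: vimage_def)
  have D: "open D"
    unfolding D_def Collect_neg_eq open_Compl
    by (intro open_Compl closed continuous_intros)
  have nonneg: "r1 w \<notin> \<real>\<^sub>\<le>\<^sub>0" "r2 w \<notin> \<real>\<^sub>\<le>\<^sub>0" if "w \<in> D" for w
    using joukowski_nonpos[of "r1 w"] joukowski_nonpos[of "r2 w"] r1 r2 that by (auto simp: D_def)
  define D1 where "D1 = D \<inter> {w. w - 2 \<notin> \<real>\<^sub>\<le>\<^sub>0}"
  define D2 where "D2 = D \<inter> {w. 2 - w \<notin> \<real>\<^sub>\<le>\<^sub>0}"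
  have "open D1" "open D2"
    unfolding D1_def D2_def Collect_neg_eq using D
    by (intro open_Int open_Compl closed continuous_intros; simp)+
  have "r1 holomorphic_on D1"
    unfolding r1_def by (intro holomorphic_intros) (auto simp: D1_def D_def)
  then have h1: "G holomorphic_on D1"
    unfolding G_def using nonneg
    by (intro holomorphic_on_compose_gen[OF _ \<Phi>, unfolded o_def]) (auto simp: D1_def)
  have "r2 holomorphic_on D2"
    unfolding r2_def by (intro holomorphic_intros) (auto simp: D2_def D_def)
  then have "(\<lambda>w. \<Phi> (r2 w)) holomorphic_on D2"
    using nonneg by (intro holomorphic_on_compose_gen[OF _ \<Phi>, unfolded o_def]) (auto simp: D2_def)
  then have h2: "G holomorphic_on D2"
    by (rule holomorphic_transform) (use unique nonneg r1 r2 in \<open>auto simp: G_def D2_def\<close>)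
  have "D - {2} = D1 \<union> D2"
  proof -
    have "w = 2" if "w - 2 \<in> \<real>\<^sub>\<le>\<^sub>0" "2 - w \<in> \<real>\<^sub>\<le>\<^sub>0" for w :: complex
      using that by (auto simp: complex_nonpos_Reals_iff complex_eq_iff)
    moreover have "2 \<notin> D1 \<union> D2" by (simp add: D1_def D2_def)
    ultimately show ?thesis by (auto simp: D1_def D2_def)
  qed
  then have h12: "G holomorphic_on D - {2}"
    using h1 h2 \<open>open D1\<close> \<open>open D2\<close> by (simp add: holomorphic_on_Un)
  \<comment> \<open>Although 2 is the branch point of \<open>csqrt (w - 2)\<close>, the norm of this
    root is the real square root of the norm, which tends to 0.\<close>
  have "(G \<longlongrightarrow> G 2) (at 2 within D)"
  proof -
    have "((\<lambda>w. csqrt (w - 2)) \<longlongrightarrow> 0) (at 2 within D)"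
    proof (rule tendsto_norm_zero_cancel)
      have "((\<lambda>w. sqrt (norm (w - 2))) \<longlongrightarrow> sqrt (norm (2 - 2 :: complex))) (at 2 within D)"
        by (intro tendsto_intros)
      then show "((\<lambda>w. norm (csqrt (w - 2))) \<longlongrightarrow> 0) (at 2 within D)" by simp
    qed
    moreover have "((\<lambda>w. csqrt (w + 2)) \<longlongrightarrow> csqrt (2 + 2)) (at 2 within D)"
      by (intro tendsto_compose[OF isContD[OF continuous_at_csqrt, unfolded isCont_def]] tendsto_intros) auto
    ultimately have "(r1 \<longlongrightarrow> ((0 + csqrt (2 + 2)) / 2)\<^sup>2) (at 2 within D)"
      unfolding r1_def by (intro tendsto_intros) auto
    also have "((0 + csqrt (2 + 2)) / 2)\<^sup>2 = r1 2" by (simp add: r1_def)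
    finally have r1_lim: "(r1 \<longlongrightarrow> r1 2) (at 2 within D)" .
    have "isCont \<Phi> (r1 2)"
    proof -
      have "r1 2 \<in> - \<real>\<^sub>\<le>\<^sub>0" using nonneg(1)[of 2] by (simp add: D_def)
      moreover have "open (- \<real>\<^sub>\<le>\<^sub>0 :: complex set)" by (simp add: open_Compl)
      ultimately show ?thesis
        using holomorphic_on_imp_continuous_on[OF \<Phi>] by (simp add: continuous_on_eq_continuous_at)
    qed
    from isCont_tendsto_compose[OF this r1_lim] show ?thesis
      by (simp only: G_def[abs_def])
  qed
  then have "G holomorphic_on D"
    by (intro no_isolated_singularity'[OF _ h12 D]) simp_all
  moreover have "G (q + 1 / q) = \<Phi> q" if "q \<notin> \<real>\<^sub>\<le>\<^sub>0" for q
    unfolding G_def using unique[OF that r1(1)] r1(2) by simp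
  ultimately show thesis
    using that unfolding D_def by blast
qed

section \<open>Behaviour on circles\<close>

definition powr_shift :: "real \<Rightarrow> complex \<Rightarrow> complex" where
  "powr_shift \<alpha> y = (1 + y) powr of_real \<alpha> - 1"

text \<open>The modulus of the continued density. Real powers of moduli avoid choosing a branch for
  the power \<open>e\<close> of \<open>powr_shift\<close>.\<close>

definition beta_type_modulus :: "real \<Rightarrow> real \<Rightarrow> real \<Rightarrow> complex \<Rightarrow> real" where
  "beta_type_modulus \<alpha> p e y = cmod (1 + y) powr - p * cmod (powr_shift \<alpha> y) powr e"

lemma one_plus_notin_nonpos_Reals: "(y::complex) \<notin> \<real>\<^sub>\<le>\<^sub>0 \<Longrightarrow> 1 + y \<notin> \<real>\<^sub>\<le>\<^sub>0"
  by (auto simp: complex_nonpos_Reals_iff)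

lemma of_real_mult_in_nonpos_Reals_iff:
  "u > 0 \<Longrightarrow> of_real u * (y::complex) \<in> \<real>\<^sub>\<le>\<^sub>0 \<longleftrightarrow> y \<in> \<real>\<^sub>\<le>\<^sub>0"
  by (auto simp: complex_nonpos_Reals_iff mult_le_0_iff)

lemma holomorphic_powr_shift: "powr_shift \<alpha> holomorphic_on - \<real>\<^sub>\<le>\<^sub>0"
  unfolding powr_shift_def using one_plus_notin_nonpos_Reals
  by (intro holomorphic_intros) auto

lemma powr_shift_cnj:
  assumes "y \<notin> \<real>\<^sub>\<le>\<^sub>0"
  shows "powr_shift \<alpha> (cnj y) = cnj (powr_shift \<alpha> y)"
proof -
  have "cnj ((1 + y) powr of_real \<alpha>) = cnj (1 + y) powr cnj (of_real \<alpha>)"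
    using one_plus_notin_nonpos_Reals[OF assms]
    by (intro cnj_powr) (auto simp: complex_nonpos_Reals_iff)
  then show ?thesis
    by (simp add: powr_shift_def)
qed

lemma powr_shift_of_real:
  "x > 0 \<Longrightarrow> powr_shift \<alpha> (of_real x) = of_real ((1 + x) powr \<alpha> - 1)"
  using powr_of_real[of "1 + x" \<alpha>] by (simp add: powr_shift_def)

lemma cis_notin_nonpos_Reals:
  assumes "0 \<le> \<tau>" "\<tau> < pi"
  shows "cis \<tau> \<notin> \<real>\<^sub>\<le>\<^sub>0"
proof (cases "\<tau> = 0")
  case False
  then have "sin \<tau> > 0" using assms by (intro sin_gt_zero) auto
  then show ?thesis by (simp add: complex_nonpos_Reals_iff)
qed auto

text \<open>At \<open>q = cis \<tau>\<close> the points u q and u / q are conjugate, so the values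
  there multiply to a squared modulus while w = 2 cos \<tau> is real. The continued function thus
  stays positive for w above \<open>2 * cos \<theta>1\<close>, and decrease in w becomes increase in
  the angle.\<close>

lemma beta_type_modulus_nondecreasing:
  fixes h :: "real \<Rightarrow> real"
  assumes "u > 0" "\<alpha> > 0" "C > 0" and cm: "completely_monotone_on {2..} h"
    and h: "\<And>v. v > 1 \<Longrightarrow> h (v + 1 / v) =
      C * beta_type_density \<alpha> p e (u * v) * (C * beta_type_density \<alpha> p e (u / v))"
    and nz: "\<And>\<tau>. 0 < \<tau> \<Longrightarrow> \<tau> < \<theta>1 \<Longrightarrow> powr_shift \<alpha> (u * cis \<tau>) \<noteq> 0"
    and \<theta>: "0 \<le> \<theta>" "\<theta> \<le> \<theta>'" "\<theta>' < \<theta>1" "\<theta>1 \<le> pi"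
  shows "beta_type_modulus \<alpha> p e (u * cis \<theta>) \<le> beta_type_modulus \<alpha> p e (u * cis \<theta>')"
proof -
  define \<Phi> where "\<Phi> q = powr_shift \<alpha> (of_real u * q) * powr_shift \<alpha> (of_real u * (1 / q))" for q
  have slit: "of_real u / q \<notin> \<real>\<^sub>\<le>\<^sub>0" if "q \<notin> \<real>\<^sub>\<le>\<^sub>0" for q :: complex
    using of_real_mult_in_nonpos_Reals_iff[OF assms(1), of "1 / q"] that
    by (simp add: one_div_in_nonpos_Reals_iff)
  have comp: "(\<lambda>q. powr_shift \<alpha> (f q)) holomorphic_on - \<real>\<^sub>\<le>\<^sub>0"
    if "f holomorphic_on - \<real>\<^sub>\<le>\<^sub>0" "f ` (- \<real>\<^sub>\<le>\<^sub>0) \<subseteq> - \<real>\<^sub>\<le>\<^sub>0" for f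
    using holomorphic_on_compose_gen[OF that(1) holomorphic_powr_shift that(2), of \<alpha>] by (simp add: o_def)
  have "(\<lambda>q. of_real u * q) holomorphic_on - \<real>\<^sub>\<le>\<^sub>0"
    by (intro holomorphic_intros)
  then have 1: "(\<lambda>q. powr_shift \<alpha> (of_real u * q)) holomorphic_on - \<real>\<^sub>\<le>\<^sub>0"
    by (rule comp) (use assms(1) in \<open>auto simp: of_real_mult_in_nonpos_Reals_iff\<close>)
  have "(\<lambda>q. of_real u * (1 / q)) holomorphic_on - \<real>\<^sub>\<le>\<^sub>0"
    by (intro holomorphic_intros) auto
  then have 2: "(\<lambda>q. powr_shift \<alpha> (of_real u * (1 / q))) holomorphic_on - \<real>\<^sub>\<le>\<^sub>0"
    by (rule comp) (use slit in auto)
  have "\<Phi> holomorphic_on - \<real>\<^sub>\<le>\<^sub>0"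
    using holomorphic_on_mult[OF 1 2] by (simp only: \<Phi>_def[abs_def])
  moreover have "\<Phi> (1 / q) = \<Phi> q" for q
    by (simp add: \<Phi>_def mult.commute)
  ultimately obtain Q where Q: "Q holomorphic_on {w. w + 2 \<notin> \<real>\<^sub>\<le>\<^sub>0}"
    "\<And>q. q \<notin> \<real>\<^sub>\<le>\<^sub>0 \<Longrightarrow> Q (q + 1 / q) = \<Phi> q"
    using holomorphic_joukowski_descent by metis
  \<comment> \<open>\<open>P\<close> and \<open>Q\<close> continue the products of the two factors
    at u v and u / v: the first is affine in w, the second comes from the descent.\<close>
  define P where "P w = 1 + of_real (u\<^sup>2) + of_real u * w" for w :: complex
  define D where "D = {w::complex. w + 2 \<notin> \<real>\<^sub>\<le>\<^sub>0}"
  have "continuous_on UNIV (\<lambda>w::complex. w + 2)" by (intro continuous_intros)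
  from closed_vimage[OF closed_nonpos_Reals_complex this] have "open D"
    by (simp add: D_def vimage_def Collect_neg_eq open_Compl)
  \<comment> \<open>Where \<open>P\<close> and \<open>Q\<close> avoid the cut, principal logarithms
    define their real powers holomorphically.\<close>
  define U where "U = {w \<in> D. P w \<notin> \<real>\<^sub>\<le>\<^sub>0 \<and> Q w \<notin> \<real>\<^sub>\<le>\<^sub>0}"
  have "open U"
  proof -
    have "open (- \<real>\<^sub>\<le>\<^sub>0 :: complex set)" by (simp add: open_Compl)
    moreover have "continuous_on D P" unfolding P_def by (intro continuous_intros)
    moreover have "continuous_on D Q"
      using Q(1) unfolding D_def by (rule holomorphic_on_imp_continuous_on)
    ultimately have "open (D \<inter> P -` (- \<real>\<^sub>\<le>\<^sub>0))" "open (D \<inter> Q -` (- \<real>\<^sub>\<le>\<^sub>0))"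
      using \<open>open D\<close> by (auto intro: continuous_open_preimage)
    then have "open ((D \<inter> P -` (- \<real>\<^sub>\<le>\<^sub>0)) \<inter> (D \<inter> Q -` (- \<real>\<^sub>\<le>\<^sub>0)))" by (rule open_Int)
    moreover have "(D \<inter> P -` (- \<real>\<^sub>\<le>\<^sub>0)) \<inter> (D \<inter> Q -` (- \<real>\<^sub>\<le>\<^sub>0)) = U" by (auto simp: U_def)
    ultimately show ?thesis by simp
  qed
  define G where "G w = of_real (C\<^sup>2) * exp (of_real (- p) * Ln (P w) + of_real e * Ln (Q w))" for w
  have "Q holomorphic_on U"
    using Q(1) by (rule holomorphic_on_subset) (auto simp: U_def D_def)
  then have G: "G holomorphic_on U"
    unfolding G_def P_def by (intro holomorphic_intros) (auto simp: U_def P_def)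
  have G_real: "G w = of_real (C\<^sup>2 * (x powr - p * y powr e))" if "P w = of_real x" "Q w = of_real y" "x > 0" "y > 0" for w x y
    using that by (simp add: G_def Ln_of_real powr_def mult.commute flip: exp_of_real exp_add)
  have large: "P (of_real w) = of_real ((1 + u * v) * (1 + u / v)) \<and>
      Q (of_real w) = of_real (((1 + u * v) powr \<alpha> - 1) * ((1 + u / v) powr \<alpha> - 1))"
    if "w = v + 1 / v" "v > 0" for v w
  proof
    have "1 + u\<^sup>2 + u * w = (1 + u * v) * (1 + u / v)"
      using that by (simp add: field_simps power2_eq_square)
    then show "P (of_real w) = of_real ((1 + u * v) * (1 + u / v))"
      unfolding P_def by (metis of_real_1 of_real_add of_real_mult)
    have "Q (of_real w) = \<Phi> (of_real v)"
      using Q(2)[of "of_real v"] that by simp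
    also have "\<dots> = powr_shift \<alpha> (of_real (u * v)) * powr_shift \<alpha> (of_real (u / v))"
      by (simp add: \<Phi>_def)
    also have "\<dots> = of_real (((1 + u * v) powr \<alpha> - 1) * ((1 + u / v) powr \<alpha> - 1))"
    proof -
      have "u * v > 0" "u / v > 0" using that assms(1) by auto
      then show ?thesis by (simp only: powr_shift_of_real flip: of_real_mult)
    qed
    finally show "Q (of_real w) = of_real (((1 + u * v) powr \<alpha> - 1) * ((1 + u / v) powr \<alpha> - 1))" .
  qed
  have circle: "P (of_real w) = of_real ((cmod (1 + u * cis \<tau>))\<^sup>2) \<and>
      Q (of_real w) = of_real ((cmod (powr_shift \<alpha> (u * cis \<tau>)))\<^sup>2) \<and> cmod (1 + u * cis \<tau>) > 0"
    if "w = 2 * cos \<tau>" "0 \<le> \<tau>" "\<tau> < pi" for \<tau> w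
  proof (intro conjI)
    have "(cmod (1 + u * cis \<tau>))\<^sup>2 = (1 + u * cos \<tau>)\<^sup>2 + (u * sin \<tau>)\<^sup>2"
      by (simp add: cmod_power2)
    also have "\<dots> = 1 + 2 * u * cos \<tau> + u\<^sup>2 * ((sin \<tau>)\<^sup>2 + (cos \<tau>)\<^sup>2)"
      by algebra
    also have "\<dots> = 1 + u\<^sup>2 + u * w" using that(1) by simp
    finally show "P (of_real w) = of_real ((cmod (1 + u * cis \<tau>))\<^sup>2)"
      by (simp add: P_def)
    have c: "cis \<tau> \<notin> \<real>\<^sub>\<le>\<^sub>0" using that(2,3) by (rule cis_notin_nonpos_Reals)
    then have uc: "u * cis \<tau> \<notin> \<real>\<^sub>\<le>\<^sub>0" using assms(1) by (simp add: of_real_mult_in_nonpos_Reals_iff)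
    have inv: "1 / cis \<tau> = cnj (cis \<tau>)" by (simp add: cis_cnj divide_inverse)
    have "Q (of_real w) = \<Phi> (cis \<tau>)"
    proof -
      have "cis \<tau> + 1 / cis \<tau> = of_real w"
        unfolding inv that(1) by (simp add: complex_add_cnj)
      then show ?thesis using Q(2)[OF c] by simp
    qed
    also have "\<dots> = powr_shift \<alpha> (u * cis \<tau>) * powr_shift \<alpha> (cnj (u * cis \<tau>))"
      unfolding \<Phi>_def inv by simp
    also have "\<dots> = of_real ((cmod (powr_shift \<alpha> (u * cis \<tau>)))\<^sup>2)"
      unfolding powr_shift_cnj[OF uc] complex_norm_square by simp
    finally show "Q (of_real w) = of_real ((cmod (powr_shift \<alpha> (u * cis \<tau>)))\<^sup>2)" .
    show "cmod (1 + u * cis \<tau>) > 0"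
      using one_plus_notin_nonpos_Reals[OF uc] by auto
  qed
  have ps0: "powr_shift \<alpha> (u * cis \<tau>) \<noteq> 0" if "0 \<le> \<tau>" "\<tau> < \<theta>1" for \<tau>
  proof (cases "\<tau> = 0")
    case True
    then show ?thesis
      using powr_shift_of_real[of u \<alpha>] powr_one_plus_minus_one_pos[of u \<alpha>] assms(1,2) by simp
  qed (use nz that in auto)
  define L where "L = 2 * cos \<theta>1"
  have sub: "of_real w \<in> U" if "w > L" for w
  proof -
    have "w + 2 > 0" using that cos_ge_minus_one[of \<theta>1] unfolding L_def by linarith
    then have "of_real w \<in> D"
      by (auto simp: D_def complex_nonpos_Reals_iff)
    moreover have "\<exists>x y. x > 0 \<and> y > 0 \<and> P (of_real w) = of_real x \<and> Q (of_real w) = of_real y"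
    proof (cases "w > 2")
      case True
      then obtain v where v: "v > 1" "w = v + 1 / v" using joukowski_inv[OF True] by metis
      then have "u * v > 0" "u / v > 0" using assms(1) by auto
      then have "(1 + u * v) powr \<alpha> - 1 > 0" "(1 + u / v) powr \<alpha> - 1 > 0" "1 + u * v > 0" "1 + u / v > 0"
        using powr_one_plus_minus_one_pos assms(2) by (auto simp del: diff_gt_0_iff_gt)
      then show ?thesis
        using large[OF v(2)] v(1)
        by (intro exI[of _ "(1 + u * v) * (1 + u / v)"]
          exI[of _ "((1 + u * v) powr \<alpha> - 1) * ((1 + u / v) powr \<alpha> - 1)"] conjI mult_pos_pos) auto
    next
      case False
      \<comment> \<open>For w between -2 and 2 the solution v of v + 1 / v = w is the point of this
        angle on the unit circle.\<close>
      define \<tau> where "\<tau> = arccos (w / 2)"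
      have w: "-1 < w / 2" "w / 2 \<le> 1" using False \<open>w + 2 > 0\<close> by auto
      have "cos \<tau> = w / 2" "0 \<le> \<tau>" "\<tau> \<le> pi"
        using w arccos_bounded[of "w / 2"] by (auto simp: \<tau>_def)
      moreover have "\<tau> < \<theta>1"
      proof (rule ccontr)
        assume "\<not> \<tau> < \<theta>1"
        then have "cos \<tau> \<le> cos \<theta>1" using \<theta> \<open>\<tau> \<le> pi\<close> by (intro cos_monotone_0_pi_le) auto
        then show False using that \<open>cos \<tau> = w / 2\<close> by (simp add: L_def)
      qed
      ultimately have \<tau>: "w = 2 * cos \<tau>" "0 \<le> \<tau>" "\<tau> < pi" "\<tau> < \<theta>1" using \<theta> by auto
      then show ?thesis
        using circle[OF \<tau>(1-3)] ps0[OF \<tau>(2,4)]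
        by (intro exI[of _ "(cmod (1 + u * cis \<tau>))\<^sup>2"] exI[of _ "(cmod (powr_shift \<alpha> (u * cis \<tau>)))\<^sup>2"]) auto
    qed
    ultimately show ?thesis by (auto simp: U_def)
  qed
  have "L \<le> 2" by (simp add: L_def)
  have eq: "G (of_real w) = of_real (h w)" if w: "w > 2" for w
  proof -
    obtain v where v: "v > 1" "w = v + 1 / v" using joukowski_inv[OF w] by metis
    then have "u * v > 0" "u / v > 0" using assms(1) by auto
    then have pos: "(1 + u * v) powr \<alpha> - 1 > 0" "(1 + u / v) powr \<alpha> - 1 > 0" "1 + u * v > 0" "1 + u / v > 0"
      using powr_one_plus_minus_one_pos assms(2) by (auto simp del: diff_gt_0_iff_gt)
    have "G (of_real w) = of_real (C\<^sup>2 * (((1 + u * v) * (1 + u / v)) powr - p *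
        (((1 + u * v) powr \<alpha> - 1) * ((1 + u / v) powr \<alpha> - 1)) powr e))"
      using large[OF v(2)] v(1) pos by (intro G_real mult_pos_pos) auto
    also have "\<dots> = of_real (h w)"
      unfolding v(2) h[OF v(1)] using pos
      by (simp add: beta_type_density_def powr_mult power2_eq_square)
    finally show ?thesis .
  qed
  have G_circle: "Re (G (of_real (2 * cos \<tau>))) = (C * beta_type_modulus \<alpha> p e (u * cis \<tau>))\<^sup>2"
    if "0 \<le> \<tau>" "\<tau> < \<theta>1" for \<tau>
  proof -
    have sq: "(x\<^sup>2) powr a = (x powr a)\<^sup>2" if "x > 0" for x a :: real
      using that by (simp add: power2_eq_square powr_mult)
    have *: "cmod (1 + u * cis \<tau>) > 0" "cmod (powr_shift \<alpha> (u * cis \<tau>)) > 0"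
      using circle[OF refl, of \<tau>] ps0[OF that] that \<theta> by auto
    have "G (of_real (2 * cos \<tau>)) = of_real (C\<^sup>2 * (((cmod (1 + u * cis \<tau>))\<^sup>2) powr - p *
        ((cmod (powr_shift \<alpha> (u * cis \<tau>)))\<^sup>2) powr e))"
      using circle[OF refl, of \<tau>] that \<theta> * by (intro G_real) auto
    then show ?thesis
      unfolding sq[OF *(1)] sq[OF *(2)] Re_complex_of_real
      by (simp add: beta_type_modulus_def power_mult_distrib)
  qed
  have "L < 2 * cos \<theta>'"
    unfolding L_def using \<theta> by (simp add: cos_monotone_0_pi)
  moreover have "2 * cos \<theta>' \<le> 2 * cos \<theta>"
    using \<theta> by (simp add: cos_monotone_0_pi_le)
  ultimately have "Re (G (of_real (2 * cos \<theta>))) \<le> Re (G (of_real (2 * cos \<theta>')))"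
    by (intro completely_monotone_on_antimono_continuation[OF cm \<open>open U\<close> G sub \<open>L \<le> 2\<close> eq]) auto
  then have "(C * beta_type_modulus \<alpha> p e (u * cis \<theta>))\<^sup>2 \<le> (C * beta_type_modulus \<alpha> p e (u * cis \<theta>'))\<^sup>2"
    using \<theta> G_circle[of \<theta>] G_circle[of \<theta>'] by simp
  moreover have "beta_type_modulus \<alpha> p e (u * cis \<theta>') \<ge> 0"
    by (simp add: beta_type_modulus_def)
  ultimately have "C * beta_type_modulus \<alpha> p e (u * cis \<theta>) \<le> C * beta_type_modulus \<alpha> p e (u * cis \<theta>')"
    using assms(3) by (metis mult_nonneg_nonneg less_imp_le power2_le_imp_le)
  then show ?thesis using assms(3) by simp
qed

section \<open>Zeros of \<open>powr_shift\<close>\<close>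

lemma powr_shift_eq_0:
  assumes "y \<notin> \<real>\<^sub>\<le>\<^sub>0" "\<alpha> > 0" "powr_shift \<alpha> y = 0"
  obtains \<psi> where "y = cis \<psi> - 1" "2 * pi / \<alpha> \<le> \<bar>\<psi>\<bar>" "\<bar>\<psi>\<bar> < pi"
proof -
  define z where "z = 1 + y"
  have z: "z \<notin> \<real>\<^sub>\<le>\<^sub>0" unfolding z_def using assms(1) by (rule one_plus_notin_nonpos_Reals)
  then have z0: "z \<noteq> 0" by auto
  have "exp (of_real \<alpha> * Ln z) = 1"
    using assms(3) z0 by (simp add: powr_shift_def powr_def z_def)
  \<comment> \<open>So \<open>z\<close> has modulus 1 and its argument is the multiple
    \<open>n\<close> of 2 pi / \<alpha>. The multiple 0 would give \<open>y = 0\<close>, a point of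
    the excluded ray.\<close>
  then obtain n :: int where n: "\<alpha> * ln (cmod z) = 0" "\<alpha> * Im (Ln z) = of_int (2 * n) * pi"
    using z0 by (auto simp: exp_eq_1)
  define \<psi> where "\<psi> = Im (Ln z)"
  have "cmod z = 1" using n(1) assms(2) z0 by simp
  then have "z = cis \<psi>"
    using exp_Ln[OF z0] exp_eq_polar[of "Ln z"] z0 by (simp add: \<psi>_def)
  moreover have "\<bar>\<psi>\<bar> < pi"
  proof -
    have "\<psi> \<noteq> pi"
      using z Im_Ln_eq_pi[OF z0] by (auto simp: \<psi>_def complex_nonpos_Reals_iff)
    then show ?thesis
      using mpi_less_Im_Ln[OF z0] Im_Ln_le_pi[OF z0] by (auto simp: \<psi>_def)
  qed
  moreover have "2 * pi / \<alpha> \<le> \<bar>\<psi>\<bar>"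
  proof -
    have "n \<noteq> 0"
    proof
      assume "n = 0"
      then have "\<psi> = 0" using n(2) assms(2) by (simp add: \<psi>_def)
      then have "y = 0" using \<open>z = cis \<psi>\<close> by (simp add: z_def)
      then show False using assms(1) by simp
    qed
    then have "1 \<le> \<bar>real_of_int n\<bar>" by linarith
    then have "2 * pi * 1 \<le> 2 * pi * \<bar>real_of_int n\<bar>"
      by (intro mult_left_mono) auto
    also have "\<dots> = \<alpha> * \<bar>\<psi>\<bar>"
      using n(2) assms(2) by (metis (no_types, opaque_lifting) \<psi>_def abs_mult abs_numeral abs_of_pos mult.assoc mult.commute of_int_mult of_int_numeral pi_gt_zero)
    finally show ?thesis using assms(2) by (simp add: field_simps)
  qed
  ultimately show thesis
    using that[of \<psi>] by (simp add: z_def eq_diff_eq add.commute)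
qed

lemma cmod_cis_minus_1: "(cmod (cis \<psi> - 1))\<^sup>2 = 2 - 2 * cos \<bar>\<psi>\<bar>"
proof -
  have "(cmod (cis \<psi> - 1))\<^sup>2 = (cos \<psi> - 1)\<^sup>2 + (sin \<psi>)\<^sup>2"
    by (simp add: cmod_power2)
  also have "\<dots> = (sin \<psi>)\<^sup>2 + (cos \<psi>)\<^sup>2 + 1 - 2 * cos \<psi>"
    by (simp add: power2_eq_square algebra_simps)
  finally show ?thesis by simp
qed

lemma powr_shift_nonzero:
  assumes "0 < \<tau>" "\<tau> < pi" "u > 0" "0 < \<alpha>" "\<alpha> \<le> 2"
  shows "powr_shift \<alpha> (of_real u * cis \<tau>) \<noteq> 0"
proof
  assume "powr_shift \<alpha> (of_real u * cis \<tau>) = 0"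
  moreover have "of_real u * cis \<tau> \<notin> \<real>\<^sub>\<le>\<^sub>0"
    using assms cis_notin_nonpos_Reals by (simp add: of_real_mult_in_nonpos_Reals_iff)
  ultimately obtain \<psi> where "2 * pi / \<alpha> \<le> \<bar>\<psi>\<bar>" "\<bar>\<psi>\<bar> < pi"
    using powr_shift_eq_0 assms(4) by metis
  then have "2 * pi / \<alpha> < pi" by simp
  then show False using assms by (simp add: field_simps)
qed

lemma isCont_powr_shift: "y \<notin> \<real>\<^sub>\<le>\<^sub>0 \<Longrightarrow> isCont (powr_shift \<alpha>) y"
proof -
  assume "y \<notin> \<real>\<^sub>\<le>\<^sub>0"
  moreover have "open (- \<real>\<^sub>\<le>\<^sub>0 :: complex set)" by (simp add: open_Compl)
  ultimately show ?thesis
    using holomorphic_on_imp_continuous_on[OF holomorphic_powr_shift]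
    by (simp add: continuous_on_eq_continuous_at)
qed

lemma beta_type_modulus_pos:
  assumes "y \<notin> \<real>\<^sub>\<le>\<^sub>0" "powr_shift \<alpha> y \<noteq> 0"
  shows "beta_type_modulus \<alpha> p e y > 0"
proof -
  have "1 + y \<noteq> 0"
    using one_plus_notin_nonpos_Reals[OF assms(1)] by (metis nonpos_Reals_zero_I)
  then show ?thesis
    using assms(2) by (simp add: beta_type_modulus_def)
qed

text \<open>The property of the density on which the case analysis rests. Zeros are excluded only at
  angles below \<open>\<theta>1\<close>, so a circle through a zero can still be used up to that
  zero.\<close>

definition circle_increasing :: "real \<Rightarrow> real \<Rightarrow> real \<Rightarrow> bool" where
  "circle_increasing \<alpha> p e \<longleftrightarrow> (\<forall>u>0. \<forall>\<theta> \<theta>' \<theta>1. 0 \<le> \<theta> \<longrightarrow> \<theta> \<le> \<theta>' \<longrightarrow> \<theta>' < \<theta>1 \<longrightarrow> \<theta>1 \<le> pi \<longrightarrow>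
    (\<forall>\<tau>. 0 < \<tau> \<longrightarrow> \<tau> < \<theta>1 \<longrightarrow> powr_shift \<alpha> (of_real u * cis \<tau>) \<noteq> 0) \<longrightarrow>
    beta_type_modulus \<alpha> p e (of_real u * cis \<theta>) \<le> beta_type_modulus \<alpha> p e (of_real u * cis \<theta>'))"

lemma circle_increasingD:
  assumes "circle_increasing \<alpha> p e" "u > 0" "0 \<le> \<theta>" "\<theta> \<le> \<theta>'" "\<theta>' < \<theta>1" "\<theta>1 \<le> pi"
    "\<And>\<tau>. 0 < \<tau> \<Longrightarrow> \<tau> < \<theta>1 \<Longrightarrow> powr_shift \<alpha> (of_real u * cis \<tau>) \<noteq> 0"
  shows "beta_type_modulus \<alpha> p e (of_real u * cis \<theta>) \<le> beta_type_modulus \<alpha> p e (of_real u * cis \<theta>')"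
  using assms unfolding circle_increasing_def by blast

lemma beta_type_modulus_of_real_pos:
  assumes "u > 0" "\<alpha> > 0"
  shows "beta_type_modulus \<alpha> p e (of_real u) > 0"
proof (rule beta_type_modulus_pos)
  show "powr_shift \<alpha> (of_real u) \<noteq> 0"
    using powr_one_plus_minus_one_pos[of u \<alpha>] assms powr_shift_of_real[of u \<alpha>]
    by (metis less_irrefl of_real_eq_0_iff)
qed (use assms in auto)

section \<open>Parameter restrictions from monotonicity on circles\<close>

lemma circle_increasing_limit_contradiction:
  assumes inc: "circle_increasing \<alpha> p e" and "u > 0" "\<alpha> > 0" "0 < \<theta>1" "\<theta>1 \<le> pi"
    and nz: "\<And>\<tau>. 0 < \<tau> \<Longrightarrow> \<tau> < \<theta>1 \<Longrightarrow> powr_shift \<alpha> (of_real u * cis \<tau>) \<noteq> 0"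
    and lim: "((\<lambda>\<theta>. beta_type_modulus \<alpha> p e (of_real u * cis \<theta>)) \<longlongrightarrow> 0) (at_left \<theta>1)"
  shows False
proof -
  have "\<forall>\<^sub>F \<theta> in at_left \<theta>1. \<theta> \<in> {0<..<\<theta>1}"
    using assms(4) by (rule eventually_at_left_real)
  then have "\<forall>\<^sub>F \<theta> in at_left \<theta>1. beta_type_modulus \<alpha> p e (of_real u) \<le> beta_type_modulus \<alpha> p e (of_real u * cis \<theta>)"
  proof eventually_elim
    case (elim \<theta>)
    then show ?case
      using circle_increasingD[OF inc assms(2), of 0 \<theta> \<theta>1] nz assms(5) by simp
  qed
  \<comment> \<open>The value at angle 0 bounds the modulus from below along the arc, hence also its
    limit.\<close>
  then have "beta_type_modulus \<alpha> p e (of_real u) \<le> 0"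
    by (intro tendsto_lowerbound[OF lim]) auto
  then show False
    using beta_type_modulus_of_real_pos[OF assms(2,3), of p e] by simp
qed

text \<open>On the unit circle 1 + y tends to 0 at angle pi, while \<open>powr_shift\<close> tends
  to -1 and leaves the limit to the power \<open>- p\<close> alone.\<close>

lemma circle_increasing_imp_p_nonneg:
  assumes inc: "circle_increasing \<alpha> p e" and \<alpha>: "0 < \<alpha>" "\<alpha> \<le> 2"
  shows "p \<ge> 0"
proof (rule ccontr)
  assume "\<not> p \<ge> 0"
  then have p: "p < 0" by simp
  have c: "((\<lambda>\<theta>. 1 + cis \<theta>) \<longlongrightarrow> 1 + cis pi) (at_left pi)"
    by (intro tendsto_intros)
  then have m: "((\<lambda>\<theta>. cmod (1 + cis \<theta>)) \<longlongrightarrow> 0) (at_left pi)"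
    using tendsto_norm[OF c] by simp
  then have "((\<lambda>\<theta>. cmod (1 + cis \<theta>) powr \<alpha>) \<longlongrightarrow> 0 powr \<alpha>) (at_left pi)"
    using \<alpha> by (intro tendsto_intros) auto
  \<comment> \<open>The logarithm has no limit at 0, so the limit of the complex power is taken
    through its modulus.\<close>
  then have "((\<lambda>\<theta>. cmod ((1 + cis \<theta>) powr of_real \<alpha>)) \<longlongrightarrow> 0) (at_left pi)"
    by (simp add: norm_powr_real_powr')
  then have "((\<lambda>\<theta>. (1 + cis \<theta>) powr of_real \<alpha>) \<longlongrightarrow> 0) (at_left pi)"
    by (rule tendsto_norm_zero_cancel)
  then have ps: "((\<lambda>\<theta>. cmod ((1 + cis \<theta>) powr of_real \<alpha> - 1)) \<longlongrightarrow> cmod (0 - 1)) (at_left pi)"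
    by (intro tendsto_intros)
  have "((\<lambda>\<theta>. beta_type_modulus \<alpha> p e (cis \<theta>)) \<longlongrightarrow> 0 powr - p * cmod (0 - 1) powr e) (at_left pi)"
    unfolding beta_type_modulus_def powr_shift_def using p
    by (intro tendsto_mult tendsto_powr'[OF m tendsto_const] tendsto_powr[OF ps tendsto_const]) auto
  then have "((\<lambda>\<theta>. beta_type_modulus \<alpha> p e (of_real 1 * cis \<theta>)) \<longlongrightarrow> 0) (at_left pi)"
    by simp
  then show False
    using \<alpha> powr_shift_nonzero[of _ 1 \<alpha>]
    by (intro circle_increasing_limit_contradiction[OF inc, of 1 pi]) auto
qed

text \<open>For \<alpha> = 2 the function is y (y + 2). The circle of radius 2 reaches the zero -2
  at angle pi, where 1 + y has modulus 1.\<close>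

lemma circle_increasing_two:
  assumes inc: "circle_increasing 2 p e"
  shows "e \<le> 0"
proof (rule ccontr)
  assume "\<not> e \<le> 0"
  then have e: "e > 0" by simp
  have c: "((\<lambda>\<theta>. 1 + 2 * cis \<theta>) \<longlongrightarrow> 1 + 2 * cis pi) (at_left pi)"
    by (intro tendsto_intros)
  have m: "((\<lambda>\<theta>. cmod (1 + 2 * cis \<theta>)) \<longlongrightarrow> 1) (at_left pi)"
    using tendsto_norm[OF c] by simp
  have "((\<lambda>\<theta>. cmod ((1 + 2 * cis \<theta>) ^ 2 - 1)) \<longlongrightarrow> cmod ((1 + 2 * cis pi) ^ 2 - 1)) (at_left pi)"
    by (intro tendsto_intros c)
  moreover have "z powr of_real 2 = z ^ 2" for z :: complex
    using powr_nat'[of z 2] by (cases "z = 0") auto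
  ultimately have "((\<lambda>\<theta>. cmod (powr_shift 2 (2 * cis \<theta>))) \<longlongrightarrow> 0) (at_left pi)"
    by (simp add: powr_shift_def)
  then have "((\<lambda>\<theta>. beta_type_modulus 2 p e (2 * cis \<theta>)) \<longlongrightarrow> 1 powr - p * 0 powr e) (at_left pi)"
    unfolding beta_type_modulus_def using m e by (intro tendsto_intros) auto
  then have "((\<lambda>\<theta>. beta_type_modulus 2 p e (of_real 2 * cis \<theta>)) \<longlongrightarrow> 0) (at_left pi)"
    by simp
  then show False
    using powr_shift_nonzero[of _ 2 2]
    by (intro circle_increasing_limit_contradiction[OF inc, of 2 pi]) auto
qed

text \<open>The candidates are \<open>cis \<psi> - 1\<close> with \<psi> of absolute value at least
  2 pi / \<alpha>. Their squared distance to the origin, 2 - 2 cos \<psi>, grows with this absolute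
  value, so the one at 2 pi / \<alpha> is the nearest, and the only such one in the upper
  half-plane.\<close>

lemma powr_shift_first_zero:
  assumes "\<alpha> > 2"
  obtains r A where "r > 0" "0 < A" "A < pi" "cmod (1 + of_real r * cis A) = 1"
    "powr_shift \<alpha> (of_real r * cis A) = 0"
    "\<And>u \<tau>. 0 < u \<Longrightarrow> u \<le> r \<Longrightarrow> 0 < \<tau> \<Longrightarrow> \<tau> < pi \<Longrightarrow> powr_shift \<alpha> (of_real u * cis \<tau>) = 0 \<Longrightarrow> u = r \<and> \<tau> = A"
proof -
  define \<psi>0 where "\<psi>0 = 2 * pi / \<alpha>"
  have \<psi>0: "0 < \<psi>0" "\<psi>0 < pi" using assms by (auto simp: \<psi>0_def field_simps)
  define y0 where "y0 = cis \<psi>0 - 1"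
  have Im: "Im y0 > 0" using \<psi>0 by (simp add: y0_def sin_gt_zero)
  then have "y0 \<noteq> 0" by auto
  define r A where "r = cmod y0" and "A = Arg y0"
  have r: "r > 0" using \<open>y0 \<noteq> 0\<close> by (simp add: r_def)
  have A: "0 < A" "A < pi" using Im Arg_lt_pi[of y0] by (auto simp: A_def)
  have y0: "of_real r * cis A = y0"
    using rcis_cmod_Arg[of y0] by (simp add: r_def A_def rcis_def)
  have zero: "powr_shift \<alpha> y0 = 0"
  proof -
    have "Ln (cis \<psi>0) = \<i> * \<psi>0"
      by (rule Ln_unique) (use \<psi>0 in \<open>auto simp: cis_conv_exp\<close>)
    then have "cis \<psi>0 powr of_real \<alpha> = exp (\<i> * of_real (2 * pi))"
      using assms by (simp add: powr_def \<psi>0_def mult.commute)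
    also have "\<dots> = 1" unfolding exp_eq_1 by (auto intro: exI[of _ 1])
    finally show ?thesis by (simp add: powr_shift_def y0_def)
  qed
  have first: "u = r \<and> \<tau> = A" if "0 < u" "u \<le> r" "0 < \<tau>" "\<tau> < pi" "powr_shift \<alpha> (of_real u * cis \<tau>) = 0" for u \<tau>
  proof -
    have "of_real u * cis \<tau> \<notin> \<real>\<^sub>\<le>\<^sub>0"
      using that cis_notin_nonpos_Reals by (simp add: of_real_mult_in_nonpos_Reals_iff)
    moreover have "\<alpha> > 0" using assms by simp
    ultimately obtain \<psi> where \<psi>: "of_real u * cis \<tau> = cis \<psi> - 1" "\<psi>0 \<le> \<bar>\<psi>\<bar>" "\<bar>\<psi>\<bar> < pi"
      using \<open>powr_shift \<alpha> (of_real u * cis \<tau>) = 0\<close> powr_shift_eq_0 unfolding \<psi>0_def by metis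
    have "u = cmod (cis \<psi> - 1)"
      using that(1) by (simp flip: \<psi>(1) add: norm_mult)
    then have "u\<^sup>2 = 2 - 2 * cos \<bar>\<psi>\<bar>" by (simp only: cmod_cis_minus_1)
    moreover have "r\<^sup>2 = 2 - 2 * cos \<psi>0"
      using \<psi>0 cmod_cis_minus_1[of \<psi>0] by (simp add: r_def y0_def)
    moreover have "u\<^sup>2 \<le> r\<^sup>2" using that by (intro power_mono) auto
    ultimately have "cos \<psi>0 \<le> cos \<bar>\<psi>\<bar>" by simp
    moreover have "cos \<bar>\<psi>\<bar> < cos \<psi>0" if "\<psi>0 < \<bar>\<psi>\<bar>"
      using that \<psi>0 \<psi>(3) by (intro cos_monotone_0_pi) auto
    ultimately have "\<bar>\<psi>\<bar> = \<psi>0" using \<psi>(2) by force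
    moreover have "sin \<psi> > 0"
    proof -
      have "u * sin \<tau> = sin \<psi>" using arg_cong[OF \<psi>(1), of Im] by simp
      moreover have "u * sin \<tau> > 0" using that by (intro mult_pos_pos sin_gt_zero) auto
      ultimately show ?thesis by simp
    qed
    then have "\<psi> > 0"
      using \<psi>(3) sin_gt_zero[of "-\<psi>"] by (cases "\<psi> = 0") (auto simp: abs_if split: if_splits)
    ultimately have "of_real u * cis \<tau> = y0" using \<psi>(1) by (simp add: y0_def)
    then have "rcis u \<tau> = y0" by (simp add: rcis_def)
    then show ?thesis
      using Arg_unique'[of u \<tau> y0] that unfolding A_def r_def by (auto simp flip: \<open>rcis u \<tau> = y0\<close>)
  qed
  have "cmod (1 + of_real r * cis A) = 1" unfolding y0 by (simp add: y0_def)
  then show thesis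
    by (rule that[OF r A _ zero[folded y0] first])
qed

text \<open>For e > 0 the modulus drops to 0 on the circle through the first zero. For e < 0 it
  blows up there, so smaller circles without zeros are used: as their radius tends to
  \<open>r\<close>, the modulus at angle \<open>A\<close> exceeds the one at the later angle
  \<open>B\<close>.\<close>

lemma circle_increasing_gt_two:
  assumes inc: "circle_increasing \<alpha> p e" and \<alpha>: "\<alpha> > 2"
  shows "e = 0"
proof -
  obtain r A where r: "r > 0" "0 < A" "A < pi" "cmod (1 + of_real r * cis A) = 1"
    "powr_shift \<alpha> (of_real r * cis A) = 0"
    "\<And>u \<tau>. 0 < u \<Longrightarrow> u \<le> r \<Longrightarrow> 0 < \<tau> \<Longrightarrow> \<tau> < pi \<Longrightarrow> powr_shift \<alpha> (of_real u * cis \<tau>) = 0 \<Longrightarrow> u = r \<and> \<tau> = A"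
    using powr_shift_first_zero[OF \<alpha>] by metis
  have slit: "of_real r * cis \<tau> \<notin> \<real>\<^sub>\<le>\<^sub>0" if "0 \<le> \<tau>" "\<tau> < pi" for \<tau>
    using that r(1) cis_notin_nonpos_Reals by (simp add: of_real_mult_in_nonpos_Reals_iff)
  have "\<not> e > 0"
  proof
    assume e: "e > 0"
    have "((\<lambda>\<theta>. of_real r * cis \<theta>) \<longlongrightarrow> of_real r * cis A) (at_left A)"
      by (intro tendsto_intros)
    then have "((\<lambda>\<theta>. cmod (powr_shift \<alpha> (of_real r * cis \<theta>))) \<longlongrightarrow> cmod (powr_shift \<alpha> (of_real r * cis A))) (at_left A)"
      and "((\<lambda>\<theta>. cmod (1 + of_real r * cis \<theta>)) \<longlongrightarrow> cmod (1 + of_real r * cis A)) (at_left A)"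
      using slit[of A] r(2,3) by (auto intro!: tendsto_intros isCont_tendsto_compose[OF isCont_powr_shift])
    then have "((\<lambda>\<theta>. beta_type_modulus \<alpha> p e (of_real r * cis \<theta>)) \<longlongrightarrow> 1 powr - p * 0 powr e) (at_left A)"
      unfolding beta_type_modulus_def r(4,5) using e by (intro tendsto_intros) auto
    then have lim: "((\<lambda>\<theta>. beta_type_modulus \<alpha> p e (of_real r * cis \<theta>)) \<longlongrightarrow> 0) (at_left A)" by simp
    show False
    proof (rule circle_increasing_limit_contradiction[OF inc r(1) _ r(2) _ _ lim])
      fix \<tau> assume "0 < \<tau>" "\<tau> < A"
      then show "powr_shift \<alpha> (of_real r * cis \<tau>) \<noteq> 0"
        using r(1,3) r(6)[of r \<tau>] by auto
    qed (use \<alpha> r(3) in auto)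
  qed
  moreover have "\<not> e < 0"
  proof
    assume e: "e < 0"
    define B where "B = (A + pi) / 2"
    have B: "A < B" "B < pi" using r(3) by (auto simp: B_def)
    \<comment> \<open>The reciprocal modulus, which stays finite for e < 0 and has a limit as the
      radius tends to \<open>r\<close>.\<close>
    define F where "F \<tau> u = cmod (1 + of_real u * cis \<tau>) powr p * cmod (powr_shift \<alpha> (of_real u * cis \<tau>)) powr - e" for \<tau> u
    have F: "beta_type_modulus \<alpha> p e (of_real u * cis \<tau>) = inverse (F \<tau> u)" for u \<tau>
      by (simp add: F_def beta_type_modulus_def powr_minus)
    have lim: "(F \<tau> \<longlongrightarrow> F \<tau> r) (at_left r)" if "0 < \<tau>" "\<tau> < pi" for \<tau>
    proof -
      have "((\<lambda>u. of_real u * cis \<tau>) \<longlongrightarrow> of_real r * cis \<tau>) (at_left r)"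
        by (intro tendsto_intros)
      then have 1: "((\<lambda>u. cmod (powr_shift \<alpha> (of_real u * cis \<tau>))) \<longlongrightarrow> cmod (powr_shift \<alpha> (of_real r * cis \<tau>))) (at_left r)"
        and 2: "((\<lambda>u. cmod (1 + of_real u * cis \<tau>)) \<longlongrightarrow> cmod (1 + of_real r * cis \<tau>)) (at_left r)"
        using slit[of \<tau>] that by (auto intro!: tendsto_intros isCont_tendsto_compose[OF isCont_powr_shift])
      have "cmod (1 + of_real r * cis \<tau>) \<noteq> 0"
        using one_plus_notin_nonpos_Reals[OF slit[of \<tau>]] that by auto
      then show ?thesis
        unfolding F_def using e
        by (intro tendsto_mult tendsto_powr[OF 2 tendsto_const] tendsto_powr'[OF 1 tendsto_const]) auto
    qed
    have "\<forall>\<^sub>F u in at_left r. F B u \<le> F A u"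
      using eventually_at_left_real[OF r(1)]
    proof eventually_elim
      case (elim u)
      have nz: "powr_shift \<alpha> (of_real u * cis \<tau>) \<noteq> 0" if "0 < \<tau>" "\<tau> < pi" for \<tau>
        using r(6)[of u \<tau>] elim that by auto
      have "inverse (F A u) \<le> inverse (F B u)"
        unfolding F[symmetric] using elim r(2) B nz
        by (intro circle_increasingD[OF inc, of u A B pi]) auto
      moreover have "F A u > 0"
      proof -
        have "of_real u * cis A \<notin> \<real>\<^sub>\<le>\<^sub>0"
          using r(2,3) elim cis_notin_nonpos_Reals by (simp add: of_real_mult_in_nonpos_Reals_iff)
        then have "beta_type_modulus \<alpha> p e (of_real u * cis A) > 0"
          using nz[of A] r(2,3) by (intro beta_type_modulus_pos)
        then show ?thesis unfolding F by simp
      qed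
      ultimately show ?case
        using inverse_le_imp_le by (cases "F B u \<le> 0") (auto simp: not_le)
    qed
    then have "F B r \<le> F A r"
      using lim[of A] lim[of B] r(2,3) B by (intro tendsto_le[of "at_left r"]) auto
    moreover have "F A r = 0" by (simp add: F_def r(5))
    moreover have "F B r > 0"
    proof -
      have "powr_shift \<alpha> (of_real r * cis B) \<noteq> 0"
        using r(6)[of r B] r(1,2) B by auto
      then have "beta_type_modulus \<alpha> p e (of_real r * cis B) > 0"
        using slit[of B] r(2) B by (intro beta_type_modulus_pos) auto
      then show ?thesis unfolding F by simp
    qed
    ultimately show False by simp
  qed
  ultimately show ?thesis by simp
qed

text \<open>
  On the upper side of the cut \<open>{..-1}\<close> the modulus continues analytically, and at the point
  \<open>-2\<close> its derivative in the angle has the sign of \<open>e * sin (pi * \<alpha>)\<close>.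
\<close>

lemma circle_increasing_sign:
  assumes inc: "circle_increasing \<alpha> p e" and \<alpha>: "0 < \<alpha>" "\<alpha> < 2"
  shows "e * sin (pi * \<alpha>) \<ge> 0"
proof (rule ccontr)
  assume "\<not> e * sin (pi * \<alpha>) \<ge> 0"
  then have neg: "e * sin (pi * \<alpha>) < 0" by simp
  \<comment> \<open>With \<delta> = pi - \<theta> and z = 1 + 2 cis \<theta>:
    \<open>A \<delta>\<close> is the argument of - z, so \<open>A \<delta> + pi\<close> is that of
    z; 5 - 4 cos \<delta> is the squared modulus of z, \<open>E\<close> that of z powr \<alpha> - 1,
    and \<open>N\<close> is twice the logarithm of the modulus. These formulas remain smooth at
    \<delta> = 0, on the cut.\<close>
  define A where "A \<delta> = arctan (- (2 * sin \<delta>) / (2 * cos \<delta> - 1))" for \<delta> :: real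
  define E where "E \<delta> = ((5 - 4 * cos \<delta>) powr (\<alpha> / 2) * cos (\<alpha> * (A \<delta> + pi)) - 1)\<^sup>2 +
      ((5 - 4 * cos \<delta>) powr (\<alpha> / 2) * sin (\<alpha> * (A \<delta> + pi)))\<^sup>2" for \<delta>
  define N where "N \<delta> = - p * ln (5 - 4 * cos \<delta>) + e * ln (E \<delta>)" for \<delta>
  have cospi: "cos (pi * \<alpha>) < 1"
    using stieltjes_weight_denominator_pos[OF \<alpha>, of 0] by simp
  have dA: "(A has_real_derivative - 2) (at 0)"
    unfolding A_def[abs_def] by (auto intro!: derivative_eq_intros simp: power2_eq_square)
  have A0: "A 0 = 0" by (simp add: A_def)
  have E0: "E 0 = 2 - 2 * cos (pi * \<alpha>)"
  proof -
    have "E 0 = (cos (pi * \<alpha>) - 1)\<^sup>2 + (sin (pi * \<alpha>))\<^sup>2"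
      by (simp add: E_def A0 mult.commute)
    also have "\<dots> = ((sin (pi * \<alpha>))\<^sup>2 + (cos (pi * \<alpha>))\<^sup>2) + 1 - 2 * cos (pi * \<alpha>)"
      by algebra
    finally show ?thesis by simp
  qed
  \<comment> \<open>The squared modulus is even in \<delta>, so its derivative vanishes at 0. For
    the same reason \<open>p\<close> drops out of the derivative of \<open>N\<close>.\<close>
  have dR: "((\<lambda>\<delta>. (5 - 4 * cos \<delta>) powr (\<alpha> / 2)) has_real_derivative 0) (at 0)"
    by (auto intro!: derivative_eq_intros)
  have dE: "(E has_real_derivative - 4 * \<alpha> * sin (pi * \<alpha>)) (at 0)"
    unfolding E_def[abs_def]
    by (rule derivative_eq_intros dR dA refl | simp)+ (simp add: A0 algebra_simps)
  have dN: "(N has_real_derivative e * (- 4 * \<alpha> * sin (pi * \<alpha>) / E 0)) (at 0)"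
    unfolding N_def[abs_def] using E0 cospi
    by (auto intro!: derivative_eq_intros dE)
  have "e * (- 4 * \<alpha> * sin (pi * \<alpha>) / E 0) > 0"
  proof -
    have "0 < (- 4 * \<alpha>) * (e * sin (pi * \<alpha>)) / E 0"
      using neg \<alpha> cospi by (intro divide_pos_pos mult_neg_neg) (auto simp: E0)
    then show ?thesis by (simp add: mult_ac)
  qed
  then obtain d where d: "d > 0" "\<And>h. h > 0 \<Longrightarrow> h < d \<Longrightarrow> N 0 < N h"
    using DERIV_pos_inc_right[OF dN] by auto
  \<comment> \<open>Below pi / 3 the real part 2 cos \<delta> - 1 of - z is positive, as the arctan
    formula for its argument requires.\<close>
  define \<delta>0 where "\<delta>0 = min d (pi / 3)"
  have \<delta>0: "\<delta>0 > 0" "\<delta>0 \<le> d" "\<delta>0 \<le> pi / 3" using d(1) by (auto simp: \<delta>0_def)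
  have N_eq: "2 * ln (beta_type_modulus \<alpha> p e (of_real 2 * cis (pi - \<delta>))) = N \<delta>"
    if "0 < \<delta>" "\<delta> < \<delta>0" for \<delta>
  proof -
    have "cos (pi / 3) < cos \<delta>"
      using that \<delta>0(3) by (intro cos_monotone_0_pi) auto
    then have c: "2 * cos \<delta> - 1 > 0" by (simp add: cos_60)
    have s: "sin \<delta> > 0" using that \<delta>0(3) by (intro sin_gt_zero) auto
    define z where "z = 1 + of_real 2 * cis (pi - \<delta>)"
    have "z = Complex (1 - 2 * cos \<delta>) (2 * sin \<delta>)"
      by (simp add: z_def complex_eq_iff)
    then have z: "Re z = 1 - 2 * cos \<delta>" "Im z = 2 * sin \<delta>" by auto
    have z0: "z \<noteq> 0" using z(2) s by auto
    have cz: "(cmod z)\<^sup>2 = 5 - 4 * cos \<delta>"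
    proof -
      have "(cmod z)\<^sup>2 = 1 - 4 * cos \<delta> + 4 * ((sin \<delta>)\<^sup>2 + (cos \<delta>)\<^sup>2)"
        unfolding cmod_power2 z by algebra
      then show ?thesis by simp
    qed
    have "Arg (- z) = A \<delta>"
      using arg_conv_arctan[of "-z"] c by (simp add: z A_def)
    then have Im: "Im (Ln z) = A \<delta> + pi"
      using Ln_minus[of "-z"] z0 z s by (simp add: Arg_eq_Im_Ln)
    define R where "R = (5 - 4 * cos \<delta>) powr (\<alpha> / 2)"
    have R: "cmod z powr \<alpha> = R"
    proof -
      have "cmod z > 0" using z0 by simp
      then have "((cmod z)\<^sup>2) powr (\<alpha> / 2) = cmod z powr \<alpha>"
        by (simp add: power2_eq_square powr_mult flip: powr_add)
      then show ?thesis by (simp add: cz R_def)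
    qed
    have "z powr of_real \<alpha> = exp (of_real \<alpha> * Ln z)" using z0 by (simp add: powr_def)
    also have "\<dots> = of_real (exp (\<alpha> * ln (cmod z))) * cis (\<alpha> * (A \<delta> + pi))"
      unfolding exp_eq_polar using z0 Im by simp
    also have "exp (\<alpha> * ln (cmod z)) = R"
      using z0 R by (simp add: powr_def)
    finally have pz: "z powr of_real \<alpha> = of_real R * cis (\<alpha> * (A \<delta> + pi))" .
    have "(cmod (powr_shift \<alpha> (of_real 2 * cis (pi - \<delta>))))\<^sup>2 = E \<delta>"
      unfolding powr_shift_def z_def[symmetric] pz E_def R_def[symmetric] cmod_power2 by simp
    moreover have ps: "powr_shift \<alpha> (of_real 2 * cis (pi - \<delta>)) \<noteq> 0"
      using that \<alpha> \<delta>0(3) by (intro powr_shift_nonzero) auto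
    ultimately have E: "ln (E \<delta>) = 2 * ln (cmod (powr_shift \<alpha> (of_real 2 * cis (pi - \<delta>))))"
      using ln_realpow[of "cmod (powr_shift \<alpha> (of_real 2 * cis (pi - \<delta>)))" 2] by simp
    have "ln (5 - 4 * cos \<delta>) = 2 * ln (cmod z)"
      using ln_realpow[of "cmod z" 2] z0 cz by simp
    then show ?thesis
      unfolding N_def E beta_type_modulus_def z_def[symmetric] using z0 ps
      by (simp add: ln_mult ln_powr algebra_simps)
  qed
  \<comment> \<open>Increase in \<theta> = pi - \<delta> means decrease in \<delta>, whereas the
    derivative at 0 forces \<open>N\<close> to rise.\<close>
  have mono: "N \<delta>' \<le> N \<delta>" if "0 < \<delta>" "\<delta> \<le> \<delta>'" "\<delta>' < \<delta>0" for \<delta> \<delta>'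
  proof -
    have lt: "\<delta>' < pi" using that \<delta>0(3) pi_gt_zero by linarith
    have nz: "powr_shift \<alpha> (of_real 2 * cis \<tau>) \<noteq> 0" if "0 < \<tau>" "\<tau> < pi" for \<tau>
      using that \<alpha> by (intro powr_shift_nonzero) auto
    have "beta_type_modulus \<alpha> p e (of_real 2 * cis (pi - \<delta>')) \<le> beta_type_modulus \<alpha> p e (of_real 2 * cis (pi - \<delta>))"
      using that lt nz by (intro circle_increasingD[OF inc, of 2 _ _ pi]) auto
    moreover have "beta_type_modulus \<alpha> p e (of_real 2 * cis (pi - \<delta>')) > 0"
    proof (rule beta_type_modulus_pos)
      have "cis (pi - \<delta>') \<notin> \<real>\<^sub>\<le>\<^sub>0" using that lt by (intro cis_notin_nonpos_Reals) auto
      then show "of_real 2 * cis (pi - \<delta>') \<notin> \<real>\<^sub>\<le>\<^sub>0"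
        using of_real_mult_in_nonpos_Reals_iff[of 2 "cis (pi - \<delta>')"] by simp
      show "powr_shift \<alpha> (of_real 2 * cis (pi - \<delta>')) \<noteq> 0" using that lt by (intro nz) auto
    qed
    ultimately have "ln (beta_type_modulus \<alpha> p e (of_real 2 * cis (pi - \<delta>'))) \<le> ln (beta_type_modulus \<alpha> p e (of_real 2 * cis (pi - \<delta>)))"
      by (simp add: ln_le_cancel_iff)
    then show ?thesis
      using N_eq[of \<delta>] N_eq[of \<delta>'] that by simp
  qed
  define \<delta>1 where "\<delta>1 = \<delta>0 / 2"
  have \<delta>1: "0 < \<delta>1" "\<delta>1 < \<delta>0" using \<delta>0 by (auto simp: \<delta>1_def)
  have "isCont N 0"
    using dN by (rule DERIV_isCont)
  then have "(N \<longlongrightarrow> N 0) (at_right 0)"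
    unfolding isCont_def by (rule filterlim_mono) (auto simp: at_within_le_at)
  moreover have "\<forall>\<^sub>F \<delta> in at_right 0. N \<delta>1 \<le> N \<delta>"
    using eventually_at_right_real[OF \<delta>1(1)] by eventually_elim (use mono \<delta>1 in auto)
  ultimately have "N \<delta>1 \<le> N 0"
    by (rule tendsto_lowerbound) simp
  then show False
    using d(2)[of \<delta>1] \<delta>1 \<delta>0 by simp
qed

section \<open>The distribution of the transformed variable\<close>

lemma circle_increasing_imp:
  assumes inc: "circle_increasing \<alpha> p e" and \<alpha>: "\<alpha> > 0"
  shows "e = 0 \<or> \<alpha> = 1 \<or> (e > 0 \<and> \<alpha> < 1) \<or> (e < 0 \<and> 1 < \<alpha> \<and> \<alpha> \<le> 2 \<and> p \<ge> 0)"
proof -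
  consider "\<alpha> < 1" | "\<alpha> = 1" | "1 < \<alpha>" "\<alpha> < 2" | "\<alpha> = 2" | "\<alpha> > 2" by linarith
  then show ?thesis
  proof cases
    case 1
    then have "sin (pi * \<alpha>) > 0" using \<alpha> by (intro sin_gt_zero) auto
    then have "e \<ge> 0"
      using circle_increasing_sign[OF inc] \<alpha> 1 by (simp add: zero_le_mult_iff)
    then show ?thesis using 1 by auto
  next
    case 3
    then have "sin (pi * \<alpha>) < 0" by (intro sin_lt_zero) auto
    then have "e \<le> 0"
      using circle_increasing_sign[OF inc] 3 by (simp add: zero_le_mult_iff)
    then show ?thesis using 3 circle_increasing_imp_p_nonneg[OF inc] by auto
  next
    case 4
    then show ?thesis using circle_increasing_two circle_increasing_imp_p_nonneg[OF inc] inc by fastforce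
  qed (use circle_increasing_gt_two[OF inc] in auto)
qed

lemma negligible_of_AE_lborel:
  fixes P :: "'a::euclidean_space \<Rightarrow> bool"
  assumes "AE x in lborel. P x"
  shows "negligible {x. \<not> P x}"
proof -
  obtain N where N: "N \<in> null_sets lborel" "{x. \<not> P x} \<subseteq> N"
    using assms by (auto simp: eventually_ae_filter)
  then have "negligible N"
    by (simp add: negligible_iff_null_sets null_sets_completionI)
  then show ?thesis using N(2) negligible_subset by blast
qed

text \<open>
  A version of the density may differ from \<open>g\<close> on a null set, but the function of \<open>v + 1 / v\<close>
  is continuous on \<open>v > 1\<close>, so it agrees there with the one of \<open>g\<close>.
\<close>

lemma AE_eq_product_unique:
  fixes f g h :: "real \<Rightarrow> real"
  assumes ae: "AE x in lborel. x > 0 \<longrightarrow> f x = g x" and u: "u > 0"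
    and h: "continuous_on {2<..} h" and g: "continuous_on {0<..} g"
    and eq: "\<And>v. v > 0 \<Longrightarrow> f (u * v) * f (u / v) = h (v + 1 / v)" and v0: "v0 > 1"
  shows "h (v0 + 1 / v0) = g (u * v0) * g (u / v0)"
proof (rule ccontr)
  assume ne: "h (v0 + 1 / v0) \<noteq> g (u * v0) * g (u / v0)"
  define D where "D v = h (v + 1 / v) - g (u * v) * g (u / v)" for v
  have gt2: "v + 1 / v > 2" if "v > 1" for v :: real
  proof -
    have "v + 1 / v - 2 = (v - 1)\<^sup>2 / v" using that by (simp add: field_simps power2_eq_square)
    also have "\<dots> > 0" using that by simp
    finally show ?thesis by simp
  qed
  have D: "continuous_on {1<..} D"
    unfolding D_def
  proof (intro continuous_on_diff continuous_on_mult)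
    show "continuous_on {1<..} (\<lambda>v. h (v + 1 / v))"
      by (rule continuous_on_compose2[OF h]) (auto intro!: continuous_intros gt2)
    show "continuous_on {1<..} (\<lambda>v. g (u * v))" "continuous_on {1<..} (\<lambda>v. g (u / v))"
      by (rule continuous_on_compose2[OF g]; use u in \<open>auto intro!: continuous_intros\<close>)+
  qed
  define W where "W = {1<..} \<inter> D -` (- {0})"
  have "open W"
    unfolding W_def by (rule continuous_open_preimage[OF D]) auto
  moreover have "v0 \<in> W" using v0 ne by (simp add: W_def D_def)
  moreover have "negligible W"
  proof -
    \<comment> \<open>A point \<open>v\<close> where the continuous functions differ has u v or u /
      v in the null set \<open>Z\<close>. Differentiable maps preserve null sets, and a nonempty
      open set is not null.\<close>
    define Z where "Z = {x. \<not> (x > 0 \<longrightarrow> f x = g x)}"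
    have Z: "negligible Z" unfolding Z_def using ae by (rule negligible_of_AE_lborel)
    have "negligible ((\<lambda>x. x / u) ` Z)" "negligible ((\<lambda>x. u / x) ` Z)"
      by (rule negligible_differentiable_image_negligible[OF _ Z];
        use u in \<open>auto simp: differentiable_on_def Z_def intro!: derivative_intros\<close>)+
    moreover have "W \<subseteq> (\<lambda>x. x / u) ` Z \<union> (\<lambda>x. u / x) ` Z"
    proof
      fix v assume v: "v \<in> W"
      then have v1: "v > 1" and "f (u * v) * f (u / v) \<noteq> g (u * v) * g (u / v)"
        using eq[of v] by (auto simp: W_def D_def)
      then have "u * v \<in> Z \<or> u / v \<in> Z" using u by (auto simp: Z_def)
      then show "v \<in> (\<lambda>x. x / u) ` Z \<union> (\<lambda>x. u / x) ` Z"
      proof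
        assume "u * v \<in> Z"
        then show ?thesis using u by (intro UnI1 image_eqI[of _ _ "u * v"]) auto
      next
        assume "u / v \<in> Z"
        then show ?thesis using u v1 by (intro UnI2 image_eqI[of _ _ "u / v"]) auto
      qed
    qed
    ultimately show ?thesis using negligible_Un negligible_subset by blast
  qed
  ultimately show False using open_not_negligible by blast
qed

section \<open>Density of the transformed variable\<close>

lemma beta_density_measurable [measurable]: "beta_density a b \<in> borel_measurable borel"
  unfolding beta_density_def[abs_def] by measurable

definition inverse_beta_density :: "real \<Rightarrow> real \<Rightarrow> real \<Rightarrow> real \<Rightarrow> real" where
  "inverse_beta_density a b s x = Gamma (a + b) / (Gamma a * Gamma b) * (1 / s) *
     beta_type_density (1 / s) (1 + (a + b - 1) / s) (b - 1) x"

text \<open>Change of variables x = (1 + y) powr (- 1 / s). Writing 1 - x as a power of 1 + y times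
  (1 + y) powr (1 / s) - 1 collects all powers of 1 + y, Jacobian included, into the exponent -
  p.\<close>

lemma beta_density_powr:
  assumes "s > 0" "y > 0"
  shows "beta_density a b ((1 + y) powr - (1 / s)) * (1 / s * (1 + y) powr (- (1 / s) - 1)) =
    inverse_beta_density a b s y"
proof -
  define \<alpha> where "\<alpha> = 1 / s"
  define z where "z = 1 + y"
  define K where "K = Gamma (a + b) / (Gamma a * Gamma b)"
  have z: "z > 1" and \<alpha>: "\<alpha> > 0" using assms by (auto simp: z_def \<alpha>_def)
  then have za: "z powr \<alpha> > 1" by simp
  have "z powr - \<alpha> < 1" using z \<alpha> powr_less_mono[of "- \<alpha>" 0 z] by simp
  moreover have "z powr - \<alpha> > 0" using z by simp
  ultimately have "beta_density a b (z powr - \<alpha>) = K * (z powr - \<alpha>) powr (a - 1) * (1 - z powr - \<alpha>) powr (b - 1)"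
    by (simp add: beta_density_def K_def)
  also have "(z powr - \<alpha>) powr (a - 1) = z powr (- \<alpha> * (a - 1))" by (simp add: powr_powr)
  also have "1 - z powr - \<alpha> = z powr - \<alpha> * (z powr \<alpha> - 1)"
    using z by (simp add: right_diff_distrib flip: powr_add)
  also have "\<dots> powr (b - 1) = z powr (- \<alpha> * (b - 1)) * (z powr \<alpha> - 1) powr (b - 1)"
    using za by (simp add: powr_mult powr_powr)
  finally have "beta_density a b (z powr - \<alpha>) * (\<alpha> * z powr (- \<alpha> - 1)) =
      K * \<alpha> * ((z powr (- \<alpha> * (a - 1)) * z powr (- \<alpha> * (b - 1)) * z powr (- \<alpha> - 1)) * (z powr \<alpha> - 1) powr (b - 1))"
    by (simp add: mult_ac)
  also have "z powr (- \<alpha> * (a - 1)) * z powr (- \<alpha> * (b - 1)) * z powr (- \<alpha> - 1) =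
      z powr (- \<alpha> * (a - 1) + - \<alpha> * (b - 1) + (- \<alpha> - 1))"
    by (simp only: powr_add)
  also have "- \<alpha> * (a - 1) + - \<alpha> * (b - 1) + (- \<alpha> - 1) = - (1 + (a + b - 1) * \<alpha>)"
    by (simp add: algebra_simps)
  finally show ?thesis
    by (simp add: inverse_beta_density_def beta_type_density_def \<alpha>_def z_def K_def)
qed

lemma inverse_beta_density_measurable [measurable]: "inverse_beta_density a b s \<in> borel_measurable borel"
  unfolding inverse_beta_density_def[abs_def] beta_type_density_def[abs_def] by measurable

lemma inverse_beta_density_pos:
  assumes "a > 0" "b > 0" "s > 0" "x > 0"
  shows "inverse_beta_density a b s x > 0"
  using assms by (auto simp: inverse_beta_density_def intro!: mult_pos_pos divide_pos_pos Gamma_real_pos beta_type_density_pos)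

lemma distributed_inverse_beta:
  fixes X :: "'a \<Rightarrow> real"
  assumes "prob_space M" and pos: "a > 0" "b > 0" "s > 0"
    and X: "distributed M lborel X (\<lambda>x. ennreal (beta_density a b x))"
  shows "distributed M lborel (\<lambda>\<omega>. X \<omega> powr (- s) - 1)
    (\<lambda>x. ennreal (inverse_beta_density a b s x * indicator {0<..} x))"
proof -
  interpret prob_space M by fact
  let ?g = "\<lambda>x. inverse_beta_density a b s x * indicator {0<..} x"
  have X_meas [measurable]: "X \<in> borel_measurable M"
    using distributed_measurable[OF X] by simp
  have main: "(\<integral>\<^sup>+x. ennreal (?g x * indicator {..c} x) \<partial>lborel) =
      emeasure M {\<omega> \<in> space M. X \<omega> powr (- s) - 1 \<le> c}" for c
  proof -
    define A where "A = {x::real. x powr (- s) - 1 \<le> c}"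
    have A [measurable]: "A \<in> sets borel" unfolding A_def by measurable
    have "emeasure M {\<omega> \<in> space M. X \<omega> powr (- s) - 1 \<le> c} = emeasure M (X -` A \<inter> space M)"
      by (rule arg_cong[of _ _ "emeasure M"]) (auto simp: A_def)
    also have "\<dots> = (\<integral>\<^sup>+x. ennreal (beta_density a b x) * indicator A x \<partial>lborel)"
      using X by (rule distributed_emeasure) simp
    also have "\<dots> = (\<integral>\<^sup>+x. ennreal (?g x * indicator {..c} x) \<partial>lborel)"
    proof (cases "c \<ge> 0")
      case False
      have "x \<notin> A" if "0 < x" "x < 1" for x
      proof -
        have "x powr - s \<ge> 1" using that pos(3) by (simp add: powr_minus powr_le1 one_le_inverse)
        then show ?thesis using False by (simp add: A_def)
      qed
      then have L: "ennreal (beta_density a b x) * indicator A x = 0" for x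
        by (auto simp: beta_density_def indicator_def)
      have R: "ennreal (?g x * indicator {..c} x) = 0" for x
        using False by (auto simp: indicator_def)
      show ?thesis by (simp only: L R)
    next
      case True
      \<comment> \<open>The value of \<open>X\<close> at which the transformed variable equals
        \<open>c\<close>. The transformation is decreasing, so values up to \<open>c\<close>
        correspond to \<open>X\<close> from \<open>k\<close> on.\<close>
      define k where "k = (1 + c) powr - (1 / s)"
      have iff: "x \<in> A \<longleftrightarrow> k \<le> x" if "0 < x" for x
      proof -
        have "x \<in> A \<longleftrightarrow> x powr - s \<le> 1 + c" by (auto simp: A_def)
        also have "\<dots> \<longleftrightarrow> (1 + c) powr - (1 / s) \<le> (x powr - s) powr - (1 / s)"
          using that True pos(3) powr_less_mono2_neg[of "- (1 / s)" "x powr - s" "1 + c"]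
            powr_less_mono2_neg[of "- (1 / s)" "1 + c" "x powr - s"]
          by (cases "x powr - s" "1 + c" rule: linorder_cases) auto
        also have "(x powr - s) powr - (1 / s) = x" using that pos(3) by (simp add: powr_powr)
        finally show ?thesis by (simp add: k_def)
      qed
      \<comment> \<open>The reflection turns the decreasing substitution into one with a nonnegative
        derivative.\<close>
      define G where "G y = - ((1 + y) powr - (1 / s))" for y
      define f where "f x = beta_density a b (- x)" for x
      have fm [measurable]: "f \<in> borel_measurable borel" unfolding f_def[abs_def] by measurable
      have "(\<integral>\<^sup>+x. ennreal (beta_density a b x) * indicator A x \<partial>lborel) =
          (\<integral>\<^sup>+x. ennreal (beta_density a b x * indicator {k..1} x) \<partial>lborel)"
        using iff by (intro nn_integral_cong) (auto simp: beta_density_def indicator_def)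
      also have "\<dots> = ennreal \<bar>- 1\<bar> * (\<integral>\<^sup>+x. ennreal (beta_density a b (0 + (- 1) * x) * indicator {k..1} (0 + (- 1) * x)) \<partial>lborel)"
        by (intro nn_integral_real_affine) auto
      also have "\<dots> = (\<integral>\<^sup>+x. ennreal (f x * indicator {G 0..G c} x) \<partial>lborel)"
        by (auto intro!: nn_integral_cong simp: f_def G_def k_def indicator_def)
      also have "\<dots> = (\<integral>\<^sup>+x. ennreal (f (G x) * (1 / s * (1 + x) powr (- (1 / s) - 1)) * indicator {0..c} x) \<partial>lborel)"
      proof (rule nn_integral_substitution)
        show "set_borel_measurable borel {G 0..G c} f"
          unfolding set_borel_measurable_def by measurable
        show "(G has_real_derivative 1 / s * (1 + x) powr (- (1 / s) - 1)) (at x)" if "x \<in> {0..c}" for x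
          unfolding G_def[abs_def] using that pos(3) by (auto intro!: derivative_eq_intros)
        show "continuous_on {0..c} (\<lambda>x. 1 / s * (1 + x) powr (- (1 / s) - 1))"
          by (intro continuous_intros) auto
      qed (use True pos in auto)
      also have "\<dots> = (\<integral>\<^sup>+x. ennreal (?g x * indicator {..c} x) \<partial>lborel)"
      proof (rule nn_integral_cong)
        fix x :: real
        consider "x < 0" | "x = 0" | "x > 0" by linarith
        then show "ennreal (f (G x) * (1 / s * (1 + x) powr (- (1 / s) - 1)) * indicator {0..c} x) =
            ennreal (?g x * indicator {..c} x)"
        proof cases
          case 3
          then show ?thesis
            using beta_density_powr[OF pos(3), of x a b]
            by (simp add: f_def G_def indicator_def)
        qed (auto simp: f_def G_def beta_density_def)
      qed
      finally show ?thesis .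
    qed
    finally show ?thesis by simp
  qed
  show ?thesis
  proof (rule distributedI_borel_atMost)
    fix c :: real
    show "emeasure M {\<omega> \<in> space M. X \<omega> powr (- s) - 1 \<le> c} =
        ennreal (measure M {\<omega> \<in> space M. X \<omega> powr (- s) - 1 \<le> c})"
      by (simp add: emeasure_eq_measure)
    then show "(\<integral>\<^sup>+x. ennreal (?g x * indicator {..c} x) \<partial>lborel) =
        ennreal (measure M {\<omega> \<in> space M. X \<omega> powr (- s) - 1 \<le> c})"
      using main[of c] by simp
  next
    show "AE x in lborel. 0 \<le> ?g x"
      using inverse_beta_density_pos[OF pos] by (intro AE_I2) (auto simp: indicator_def less_imp_le)
  qed measurable
qed

lemma continuous_on_beta_type_density:
  assumes "\<alpha> > 0"
  shows "continuous_on {0<..} (beta_type_density \<alpha> p e)"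
proof -
  have "(1 + x) powr \<alpha> - 1 \<noteq> 0" if "x > 0" for x
    using powr_one_plus_minus_one_pos[OF that assms] by simp
  then show ?thesis
    unfolding beta_type_density_def[abs_def] by (intro continuous_intros) auto
qed

theorem theorem2:
  fixes M :: "'a measure" and X :: "'a \<Rightarrow> real" and a b s :: real
  assumes "prob_space M"
    and "a > 0" and "b > 0" and "s > 0"
    and "distributed M lborel X (\<lambda>x. ennreal (beta_density a b x))"
  shows "HCM_random_variable M (\<lambda>\<omega>. X \<omega> powr (- s) - 1) \<longleftrightarrow>
     min b s > 1 \<or>
     (b = 1 \<or> s = 1) \<or>
     (b < 1 \<and> s \<in> {1/2..<1} \<and> a + b + s \<ge> 1)"
proof -
  interpret prob_space M by fact
  define Y where "Y \<omega> = X \<omega> powr (- s) - 1" for \<omega>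
  define \<alpha> where "\<alpha> = 1 / s"
  define p where "p = 1 + (a + b - 1) / s"
  define C where "C = Gamma (a + b) / (Gamma a * Gamma b) * (1 / s)"
  define g where "g = inverse_beta_density a b s"
  have \<alpha>: "\<alpha> > 0" using assms by (simp add: \<alpha>_def)
  have C: "C > 0" using assms by (auto simp: C_def intro!: mult_pos_pos divide_pos_pos Gamma_real_pos)
  have g: "g x = C * beta_type_density \<alpha> p (b - 1) x" for x
    by (simp add: g_def inverse_beta_density_def C_def \<alpha>_def p_def)
  have g_pos: "g x > 0" if "x > 0" for x
    unfolding g_def using assms that by (intro inverse_beta_density_pos)
  have Y: "distributed M lborel Y (\<lambda>x. ennreal (g x * indicator {0<..} x))"
    unfolding Y_def g_def using assms by (intro distributed_inverse_beta)
  have p: "p \<ge> 0 \<longleftrightarrow> a + b + s \<ge> 1"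
    using assms(4) by (simp add: p_def field_simps)
  have cond: "(b - 1 = 0 \<or> \<alpha> = 1 \<or> (b - 1 > 0 \<and> \<alpha> < 1) \<or> (b - 1 < 0 \<and> 1 < \<alpha> \<and> \<alpha> \<le> 2 \<and> p \<ge> 0)) \<longleftrightarrow>
    min b s > 1 \<or> (b = 1 \<or> s = 1) \<or> (b < 1 \<and> s \<in> {1/2..<1} \<and> a + b + s \<ge> 1)"
    unfolding p using assms(4) by (auto simp: \<alpha>_def field_simps)
  have "HCM_random_variable M Y \<longleftrightarrow>
    (b - 1 = 0 \<or> \<alpha> = 1 \<or> (b - 1 > 0 \<and> \<alpha> < 1) \<or> (b - 1 < 0 \<and> 1 < \<alpha> \<and> \<alpha> \<le> 2 \<and> p \<ge> 0))" (is "_ \<longleftrightarrow> ?c")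
  proof
    assume c: ?c
    \<comment> \<open>For b >= 1 or s = 1 the inequality a + b + s >= 1 follows from the positivity
      of the parameters.\<close>
    have "p \<ge> 0"
    proof (cases "b \<ge> 1 \<or> \<alpha> = 1")
      case True
      then have "a + b + s \<ge> 1" using assms by (auto simp: \<alpha>_def field_simps)
      then show ?thesis using p by simp
    qed (use c in auto)
    then have "hcm (\<lambda>x. C * beta_type_density \<alpha> p (b - 1) x)"
      using c \<alpha> C by (intro hcm_mult hcm_const hcm_beta_type_density) auto
    then have "hcm g" by (simp flip: g)
    then have "hyperbolically_completely_monotone g"
      using g_pos by (rule hcm_imp_hyperbolically_completely_monotone)
    moreover have "AE \<omega> in M. Y \<omega> > 0"
    proof -
      have "AE x in lborel. 0 < ennreal (g x * indicator {0<..} x) \<longrightarrow> x > 0"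
        by (intro AE_I2) (auto simp: indicator_def)
      then show ?thesis
        using distributed_AE2[OF Y, of "\<lambda>x. x > 0"] by simp
    qed
    ultimately show "HCM_random_variable M Y"
      using Y unfolding HCM_random_variable_def by blast
  next
    assume "HCM_random_variable M Y"
    then obtain f where f: "hyperbolically_completely_monotone f"
      "distributed M lborel Y (\<lambda>x. ennreal (f x * indicator {0<..} x))"
      unfolding HCM_random_variable_def by blast
    \<comment> \<open>Uniqueness of densities compares values in \<open>ennreal\<close>; positivity
      of \<open>f\<close> and \<open>g\<close> brings the equality back to the reals.\<close>
    have "AE x in lborel. x > 0 \<longrightarrow> f x = g x"
      using distributed_unique[OF f(2) Y]
    proof eventually_elim
      case (elim x)
      have "f x > 0" if "x > 0"
        using f(1) that by (simp add: hyperbolically_completely_monotone_def)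
      then show ?case using elim g_pos[of x] by (auto simp: indicator_def less_imp_le)
    qed
    note ae = this
    have cont_g: "continuous_on {0<..} g"
      unfolding g using \<alpha> by (intro continuous_intros continuous_on_beta_type_density)
    have "circle_increasing \<alpha> p (b - 1)"
      unfolding circle_increasing_def
    proof (intro allI impI)
      fix u \<theta> \<theta>' \<theta>1 :: real
      assume u: "u > 0" and \<theta>: "0 \<le> \<theta>" "\<theta> \<le> \<theta>'" "\<theta>' < \<theta>1" "\<theta>1 \<le> pi"
        and nz: "\<forall>\<tau>. 0 < \<tau> \<longrightarrow> \<tau> < \<theta>1 \<longrightarrow> powr_shift \<alpha> (of_real u * cis \<tau>) \<noteq> 0"
      obtain h where h: "completely_monotone_on {2..} h"
        "\<And>v. v > 0 \<Longrightarrow> f (u * v) * f (u / v) = h (v + 1 / v)"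
        using f(1) u unfolding hyperbolically_completely_monotone_def by blast
      have "h differentiable (at x)" if "x > 2" for x
        using h(1) that unfolding completely_monotone_on_def by (elim allE[of _ 0]) auto
      then have "continuous_on {2<..} h"
        by (intro continuous_at_imp_continuous_on ballI differentiable_imp_continuous_within) auto
      then have "h (v + 1 / v) = g (u * v) * g (u / v)" if "v > 1" for v
        using AE_eq_product_unique[OF ae u _ cont_g h(2) that] by simp
      then show "beta_type_modulus \<alpha> p (b - 1) (of_real u * cis \<theta>) \<le> beta_type_modulus \<alpha> p (b - 1) (of_real u * cis \<theta>')"
        using nz by (intro beta_type_modulus_nondecreasing[OF u \<alpha> C h(1) _ _ \<theta>]) (auto simp: g)
    qed
    then show ?c using \<alpha> by (rule circle_increasing_imp)
  qed
  then show ?thesis unfolding cond Y_def .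
qed

end
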